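(* For each $n\in\mathbb{N}$, there exist matrices $H,H_0\in\mathfrak{sl}(n+1,\mathbb{C})$ and a constant $c\in\mathbb{C}$ such that the Lie potential $\mathbf{f}_H$ on the minimal adjoint orbit $\mathcal{O}_n$ and the toric potential $\mathbf{h}_c$ on the cotangent bundle $T^*\mathbb{P}^n$ coincide on dense open charts, that is, $\mathbf{f}_H=\mathbf{h}_c$.
   Context: Minimal orbit. $\mathcal{O}_n=\{gH_0g^{-1}: g\in \mathrm{SL}(n+1,\mathbb{C})\}\subset\mathfrak{sl}(n+1,\mathbb{C})$ is the adjoint orbit of $H_0=\mathrm{Diag}(n,-1,\ldots,-1)$. Height function. Let $H=\mathrm{Diag}(\lambda_1,\ldots,\lambda_{n+1})\in\mathfrak{sl}(n+1,\mathbb{C})$ be a real diagonal matrix that is regular, i.e. no root vanishes on $H$ (equivalently, the $\lambda_i$ are pairwise distinct). The height function is $f_H\colon\mathcal{O}_n\to\mathbb{C}$, $f_H(A)=\langle H,A\rangle$, where $\langle A,B\rangle=2(n+1)\,\mathrm{tr}(AB)$ is the Cartan–Killing form. Chart around $H_0$. For $\mathbf{x}=(x_1,\ldots,x_n)$ and $\mathbf{y}=(y_1,\ldots,y_n)$ in $\mathbb{C}^n$ let $$X=\begin{pmatrix}0&\mathbf{x}\\0&0_{n\times n}\end{pmatrix},\qquad Y=\begin{pmatrix}0&0\\ \mathbf{y}^T&0_{n\times n}\end{pmatrix}.$$ The map $(Y,X)\mapsto e^{\mathrm{ad}(Y)}e^{\mathrm{ad}(X)}H_0$ defines a coordinate chart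 of $\mathcal{O}_n$ around $H_0$ with open and dense image. Lie potential. The expression of $f_H$ written on a chart around $H_0$ is called the Lie potential on $\mathcal{O}_n$; it is given by $$\mathbf{f}_H=\mathrm{tr}(HH_0)+(\lambda_1-\lambda_2)x_1y_1+\cdots+(\lambda_1-\lambda_{n+1})x_ny_n .$$ Toric potential. On $T^*\mathbb{P}^n$, with its canonical symplectic form, let $V_0=\{x_0\neq0\}$ be the open chart with coordinates $([1,x_1,\ldots,x_n],(y_1,\ldots,y_n))$, the $y_i$ being fibre coordinates. Consider the Hamiltonian action of $\mathbb{C}^*$ given on $V_0$ by $$t\cdot([1,x_1,\ldots,x_n],(y_1,\ldots,y_n))=([1,t^{-1}x_1,\ldots,t^{-n}x_n],(ty_1,\ldots,t^ny_n)).$$ The toric potential associated with this action is, for $c\in\mathbb{C}$, the function $\mathbf{h}_c$ given on $V_0$ by $$\mathbf{h}_c=c-2x_1y_1-\cdots-2n\,x_ny_n=c-\sum_{i=1}^n 2i\,x_iy_i .$$ *)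

theory Defs
  imports
    "HOL-Analysis.Product_Topology"
    "Jordan_Normal_Form.Determinant"
begin

text \<open>Indices are 0-based: the coordinates \<open>x\<^sub>i\<close>, \<open>y\<^sub>i\<close> with \<open>1 \<le> i \<le> n\<close> are the entries \<open>i - 1\<close> of
  vectors of dimension \<open>n\<close>, while \<open>\<lambda>\<^sub>i\<close> with \<open>1 \<le> i \<le> n + 1\<close> is the diagonal entry \<open>i - 1\<close> of a
  matrix of size \<open>n + 1\<close>.\<close>

section \<open>The minimal adjoint orbit\<close>

definition mat_trace :: "'a::comm_monoid_add mat \<Rightarrow> 'a" where
  "mat_trace A = (\<Sum>i<dim_row A. A $$ (i, i))"

definition sl :: "nat \<Rightarrow> complex mat set" where
  "sl m = {A \<in> carrier_mat m m. mat_trace A = 0}"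

definition SL :: "nat \<Rightarrow> complex mat set" where
  "SL m = {g \<in> carrier_mat m m. det g = 1}"

definition min_diag :: "nat \<Rightarrow> complex mat" where
  "min_diag n = mat_diag (n + 1) (\<lambda>i. if i = 0 then of_nat n else - 1)"

definition adjoint_orbit :: "nat \<Rightarrow> complex mat \<Rightarrow> complex mat set" where
  "adjoint_orbit m A = {g * A * g' | g g'. g \<in> SL m \<and> g' \<in> carrier_mat m m \<and> inverts_mat g g'}"

definition regular_real_diag :: "nat \<Rightarrow> complex mat \<Rightarrow> bool" where
  "regular_real_diag m H \<longleftrightarrow>
    (\<exists>l :: nat \<Rightarrow> real. H = mat_diag m (\<lambda>i. of_real (l i)) \<and> inj_on l {..<m})"

definition killing_form :: "nat \<Rightarrow> complex mat \<Rightarrow> complex mat \<Rightarrow> complex" where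
  "killing_form n A B = 2 * of_nat (n + 1) * mat_trace (A * B)"

definition height :: "nat \<Rightarrow> complex mat \<Rightarrow> complex mat \<Rightarrow> complex" where
  "height n H A = killing_form n H A"

definition X_mat :: "nat \<Rightarrow> complex vec \<Rightarrow> complex mat" where
  "X_mat n x = four_block_mat (0\<^sub>m 1 1) (mat_of_row x) (0\<^sub>m n 1) (0\<^sub>m n n)"

definition Y_mat :: "nat \<Rightarrow> complex vec \<Rightarrow> complex mat" where
  "Y_mat n y = four_block_mat (0\<^sub>m 1 1) (0\<^sub>m 1 n) (transpose_mat (mat_of_row y)) (0\<^sub>m n n)"

definition ad :: "complex mat \<Rightarrow> complex mat \<Rightarrow> complex mat" where
  "ad X A = X * A - A * X"

text \<open>\<open>exp_ad X A\<close> is $e^{\mathrm{ad}(X)}A$. Types \<open>_ mat\<close> carry no topology, so the exponential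
  series is summed entrywise.\<close>

definition exp_ad :: "complex mat \<Rightarrow> complex mat \<Rightarrow> complex mat" where
  "exp_ad X A = mat (dim_row A) (dim_col A) (\<lambda>ij. \<Sum>k. ((ad X ^^ k) A) $$ ij / fact k)"

definition lie_chart :: "nat \<Rightarrow> complex mat \<Rightarrow> complex vec \<times> complex vec \<Rightarrow> complex mat" where
  "lie_chart n H\<^sub>0 = (\<lambda>(x, y). exp_ad (Y_mat n y) (exp_ad (X_mat n x) H\<^sub>0))"

definition lie_potential ::
    "nat \<Rightarrow> complex mat \<Rightarrow> complex mat \<Rightarrow> complex vec \<times> complex vec \<Rightarrow> complex" where
  "lie_potential n H H\<^sub>0 xy = height n H (lie_chart n H\<^sub>0 xy)"

text \<open>The customary closed form of the Lie potential. It is normalised differently from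
  \<^const>\<open>lie_potential\<close>: with the factor \<open>2(n + 1)\<close> of the Killing form, and since
  \<open>[X, H\<^sub>0] = -(n + 1) X\<close>, the latter has constant term \<open>2(n + 1) tr(H H\<^sub>0)\<close> and coefficients
  \<open>2(n + 1)\<^sup>2 (\<lambda>\<^sub>1 - \<lambda>\<^sub>i\<^sub>+\<^sub>1)\<close>. Both versions are kept.\<close>

definition lie_potential_formula ::
    "nat \<Rightarrow> complex mat \<Rightarrow> complex mat \<Rightarrow> complex vec \<times> complex vec \<Rightarrow> complex" where
  "lie_potential_formula n H H\<^sub>0 = (\<lambda>(x, y).
    mat_trace (H * H\<^sub>0) + (\<Sum>i<n. (H $$ (0, 0) - H $$ (Suc i, Suc i)) * x $ i * y $ i))"

section \<open>Topologies and charts\<close>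

definition vec_top :: "nat \<Rightarrow> complex vec topology" where
  "vec_top n = pullback_topology (carrier_vec n) (\<lambda>v. restrict (($) v) {..<n})
     (product_topology (\<lambda>_. euclidean) {..<n})"

definition mat_top :: "nat \<Rightarrow> complex mat topology" where
  "mat_top m = pullback_topology (carrier_mat m m) (\<lambda>A. restrict (($$) A) ({..<m} \<times> {..<m}))
     (product_topology (\<lambda>_. euclidean) ({..<m} \<times> {..<m}))"

lemma topspace_vec_top [simp]: "topspace (vec_top n) = carrier_vec n"
  by (auto simp: vec_top_def topspace_pullback_topology)

lemma topspace_mat_top [simp]: "topspace (mat_top m) = carrier_mat m m"
  by (auto simp: mat_top_def topspace_pullback_topology)

abbreviation coord_top :: "nat \<Rightarrow> (complex vec \<times> complex vec) topology" where
  "coord_top n \<equiv> prod_topology (vec_top n) (vec_top n)"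

definition orbit_top :: "nat \<Rightarrow> complex mat \<Rightarrow> complex mat topology" where
  "orbit_top n H\<^sub>0 = subtopology (mat_top (n + 1)) (adjoint_orbit (n + 1) H\<^sub>0)"

definition dense_open_chart :: "'a topology \<Rightarrow> 'b topology \<Rightarrow> ('a \<Rightarrow> 'b) \<Rightarrow> bool" where
  "dense_open_chart C M \<phi> \<longleftrightarrow>
    embedding_map C M \<phi> \<and> openin M (\<phi> ` topspace C) \<and> M closure_of (\<phi> ` topspace C) = topspace M"

section \<open>The cotangent bundle of projective space\<close>

text \<open>A covector of \<open>\<P>\<^sup>n\<close> at \<open>[z]\<close> pulls back to a covector of \<open>\<complex>\<^sup>n\<^sup>+\<^sup>1 - {0}\<close> at \<open>z\<close> which vanishes on
  the line through \<open>z\<close>, and replacing \<open>z\<close> by \<open>s z\<close> scales this pullback \<open>\<xi>\<close> by \<open>1/s\<close>.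
  Hence \<open>T\<^sup>*\<P>\<^sup>n\<close> is the quotient of \<open>{(z, \<xi>). z \<noteq> 0 \<and> \<xi> \<bullet> z = 0}\<close> by \<open>(z, \<xi>) \<sim> (s z, \<xi>/s)\<close>;
  here \<open>\<bullet>\<close> is the bilinear product. Points are equivalence classes and the topology is the
  quotient topology.\<close>

definition cot_pairs :: "nat \<Rightarrow> (complex vec \<times> complex vec) set" where
  "cot_pairs n = {(z, \<xi>). z \<in> carrier_vec (n + 1) \<and> \<xi> \<in> carrier_vec (n + 1) \<and>
     z \<noteq> 0\<^sub>v (n + 1) \<and> \<xi> \<bullet> z = 0}"

definition cot_class :: "complex vec \<times> complex vec \<Rightarrow> (complex vec \<times> complex vec) set" where
  "cot_class = (\<lambda>(z, \<xi>). {(s \<cdot>\<^sub>v z, inverse s \<cdot>\<^sub>v \<xi>) | s. s \<noteq> 0})"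

definition cot_proj :: "nat \<Rightarrow> (complex vec \<times> complex vec) set set" where
  "cot_proj n = cot_class ` cot_pairs n"

definition cot_top :: "nat \<Rightarrow> (complex vec \<times> complex vec) set topology" where
  "cot_top n = topology (\<lambda>U. U \<subseteq> cot_proj n \<and>
     openin (subtopology (prod_topology (vec_top (n + 1)) (vec_top (n + 1))) (cot_pairs n))
       {p \<in> cot_pairs n. cot_class p \<in> U})"

lemma openin_cot_top:
  "openin (cot_top n) U \<longleftrightarrow> U \<subseteq> cot_proj n \<and>
     openin (subtopology (prod_topology (vec_top (n + 1)) (vec_top (n + 1))) (cot_pairs n))
       {p \<in> cot_pairs n. cot_class p \<in> U}"
proof -
  let ?T = "subtopology (prod_topology (vec_top (n + 1)) (vec_top (n + 1))) (cot_pairs n)"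
  let ?P = "\<lambda>U. U \<subseteq> cot_proj n \<and> openin ?T {p \<in> cot_pairs n. cot_class p \<in> U}"
  have "istopology ?P"
    unfolding istopology_def
  proof (intro conjI allI impI)
    fix S T assume *: "?P S" "?P T"
    have "{p \<in> cot_pairs n. cot_class p \<in> S \<inter> T} =
      {p \<in> cot_pairs n. cot_class p \<in> S} \<inter> {p \<in> cot_pairs n. cot_class p \<in> T}" by auto
    then show "openin ?T {p \<in> cot_pairs n. cot_class p \<in> S \<inter> T}"
      using * by (simp only:) (intro openin_Int, auto)
    show "S \<inter> T \<subseteq> cot_proj n" using * by blast
  next
    fix K assume *: "\<forall>S\<in>K. ?P S"
    have "{p \<in> cot_pairs n. cot_class p \<in> \<Union>K} =
      (\<Union>S\<in>K. {p \<in> cot_pairs n. cot_class p \<in> S})" by auto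
    then show "openin ?T {p \<in> cot_pairs n. cot_class p \<in> \<Union>K}"
      using * by (simp only:) (intro openin_Union, auto)
    show "\<Union>K \<subseteq> cot_proj n" using * by blast
  qed
  then show ?thesis
    unfolding cot_top_def by (simp add: topology_inverse')
qed

lemma topspace_cot_top [simp]: "topspace (cot_top n) = cot_proj n"
proof
  show "topspace (cot_top n) \<subseteq> cot_proj n"
    using openin_cot_top openin_topspace by blast
  have "{p \<in> cot_pairs n. cot_class p \<in> cot_proj n} = cot_pairs n"
    by (auto simp: cot_proj_def)
  moreover have "cot_pairs n \<subseteq> topspace (prod_topology (vec_top (n + 1)) (vec_top (n + 1)))"
    by (auto simp: cot_pairs_def)
  ultimately have "openin (cot_top n) (cot_proj n)"
    unfolding openin_cot_top by (metis openin_subtopology_refl order_refl)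
  then show "cot_proj n \<subseteq> topspace (cot_top n)"
    by (rule openin_subset)
qed

text \<open>The coordinates \<open>([1, x\<^sub>1, \<dots>, x\<^sub>n], (y\<^sub>1, \<dots>, y\<^sub>n))\<close> on \<open>V\<^sub>0\<close>: the covector is
  \<open>y\<^sub>1 dx\<^sub>1 + \<dots> + y\<^sub>n dx\<^sub>n\<close>, whose pullback along \<open>x\<^sub>i = z\<^sub>i / z\<^sub>0\<close> at \<open>z = (1, x)\<close> is
  \<open>\<xi> = (- x \<bullet> y, y)\<close>. The image of the chart is \<open>V\<^sub>0 = {z\<^sub>0 \<noteq> 0}\<close>.\<close>

definition cot_chart ::
    "nat \<Rightarrow> complex vec \<times> complex vec \<Rightarrow> (complex vec \<times> complex vec) set" where
  "cot_chart n = (\<lambda>(x, y). cot_class (vCons 1 x, vCons (- (x \<bullet> y)) y))"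

definition V0 :: "nat \<Rightarrow> (complex vec \<times> complex vec) set set" where
  "V0 n = cot_class ` {(z, \<xi>) \<in> cot_pairs n. z $ 0 \<noteq> 0}"

text \<open>A function on \<open>V\<^sub>0\<close>, given by its expression in the coordinates \<open>(x, y)\<close> of a point; its values
  outside \<open>V\<^sub>0\<close> are irrelevant.\<close>

definition toric_potential :: "nat \<Rightarrow> complex \<Rightarrow> (complex vec \<times> complex vec) set \<Rightarrow> complex" where
  "toric_potential n c p =
    (case inv_into (carrier_vec n \<times> carrier_vec n) (cot_chart n) p of
       (x, y) \<Rightarrow> c - (\<Sum>i<n. 2 * of_nat (Suc i) * x $ i * y $ i))"

end

theory Submission
  imports Defs "HOL-Analysis.Abstract_Limits"
begin

text \<open>Since \<open>X\<close> and \<open>Y\<close> square to zero, \<open>e\<^bsup>ad X\<^esup>A = (1 + X) A (1 - X)\<close>, and likewise for \<open>Y\<close>. The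
  orbit of \<open>H\<^sub>0 = (n + 1) e\<^sub>0 e\<^sub>0\<^sup>T - 1\<close> consists of matrices \<open>(n + 1) v w\<^sup>T - 1\<close> with \<open>w \<bullet> v = 1\<close>, and
  the Lie chart sends \<open>(x, y)\<close> to the one with \<open>v = (1, y)\<close> and \<open>w = (1 + x \<bullet> y, - x)\<close>. Its image
  is given by \<open>v\<^sub>0 \<noteq> 0\<close>, that is, row 0 of \<open>A + 1\<close> is nonzero; there \<open>x\<close> is read off that row, and
  \<open>y\<close> is recovered by applying \<open>A + 1\<close> to the conjugate of that row. The trace against
  \<open>diag(\<lambda>)\<close> is affine in the products \<open>x\<^sub>i y\<^sub>i\<close> with coefficients proportional to
  \<open>\<lambda>\<^sub>1 - \<lambda>\<^sub>i\<^sub>+\<^sub>1\<close>, so equally spaced \<open>\<lambda>\<^sub>i\<close> centred at 0 give the toric potential. Both charts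
  are dense because a point outside the image has a nonzero coordinate \<open>l \<noteq> 0\<close> of \<open>v\<close>
  (respectively \<open>z\<close>), which allows coordinate 0 to be perturbed to \<open>\<epsilon> \<noteq> 0\<close> while a compensating
  change of the dual vector in coordinate \<open>l\<close> preserves the pairing.\<close>

section \<open>Functions into and out of vector and matrix spaces\<close>

text \<open>Continuity on an abstract topology is tested by limits along the filter
  \<open>atin\<close>, where the usual limit rules apply; the next two rules follow the same
  pattern.\<close>

lemma continuous_map_mult_algebra:
  fixes f g :: "'a \<Rightarrow> 'b::real_normed_algebra"
  shows "continuous_map X euclidean f \<Longrightarrow> continuous_map X euclidean g \<Longrightarrow>
    continuous_map X euclidean (\<lambda>x. f x * g x)"
  by (simp add: continuous_map_atin tendsto_mult)

lemma continuous_map_divide_field: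
  fixes f g :: "'a \<Rightarrow> 'b::real_normed_field"
  shows "continuous_map X euclidean f \<Longrightarrow> continuous_map X euclidean g \<Longrightarrow>
    (\<And>x. x \<in> topspace X \<Longrightarrow> g x \<noteq> 0) \<Longrightarrow> continuous_map X euclidean (\<lambda>x. f x / g x)"
  by (simp add: continuous_map_atin tendsto_divide)

lemma continuous_map_cnj:
  "continuous_map X euclidean f \<Longrightarrow> continuous_map X euclidean (\<lambda>x. cnj (f x))"
  by (simp add: continuous_map_atin tendsto_cnj)

lemma continuous_map_vec_index:
  assumes "i < n"
  shows "continuous_map (vec_top n) euclidean (\<lambda>v. v $ i)"
proof -
  have "continuous_map (vec_top n) euclidean ((\<lambda>f. f i) \<circ> (\<lambda>v. restrict (($) v) {..<n}))"
    unfolding vec_top_def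
    by (intro continuous_map_pullback continuous_map_product_projection) (use assms in auto)
  then show ?thesis using assms by (simp add: o_def)
qed

lemma continuous_map_vec_top:
  assumes "\<And>t. t \<in> topspace T \<Longrightarrow> f t \<in> carrier_vec n"
    and "\<And>i. i < n \<Longrightarrow> continuous_map T euclidean (\<lambda>t. f t $ i)"
  shows "continuous_map T (vec_top n) f"
  unfolding vec_top_def
proof (rule continuous_map_pullback')
  show "continuous_map T (product_topology (\<lambda>_. euclidean) {..<n}) ((\<lambda>v. restrict (($) v) {..<n}) \<circ> f)"
    using assms(2) by (auto simp: continuous_map_componentwise o_def)
  show "topspace T \<subseteq> f -` carrier_vec n" using assms(1) by auto
qed

lemma continuous_map_mat_index:
  assumes "i < m" "j < m"
  shows "continuous_map (mat_top m) euclidean (\<lambda>A. A $$ (i, j))"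
proof -
  have "continuous_map (mat_top m) euclidean
      ((\<lambda>f. f (i, j)) \<circ> (\<lambda>A. restrict (($$) A) ({..<m} \<times> {..<m})))"
    unfolding mat_top_def
    by (intro continuous_map_pullback continuous_map_product_projection) (use assms in auto)
  then show ?thesis using assms by (simp add: o_def)
qed

lemma continuous_map_mat_top:
  assumes "\<And>t. t \<in> topspace T \<Longrightarrow> f t \<in> carrier_mat m m"
    and "\<And>i j. i < m \<Longrightarrow> j < m \<Longrightarrow> continuous_map T euclidean (\<lambda>t. f t $$ (i, j))"
  shows "continuous_map T (mat_top m) f"
  unfolding mat_top_def
proof (rule continuous_map_pullback')
  show "continuous_map T (product_topology (\<lambda>_. euclidean) ({..<m} \<times> {..<m}))
      ((\<lambda>A. restrict (($$) A) ({..<m} \<times> {..<m})) \<circ> f)"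
    using assms(2) by (auto simp: continuous_map_componentwise o_def)
  show "topspace T \<subseteq> f -` carrier_mat m m" using assms(1) by auto
qed

lemma continuous_map_fst_index:
  "i < n \<Longrightarrow> continuous_map (prod_topology (vec_top n) T) euclidean (\<lambda>p. fst p $ i)"
  using continuous_map_compose[OF continuous_map_fst continuous_map_vec_index]
  by (simp add: o_def)

lemma continuous_map_snd_index:
  "i < n \<Longrightarrow> continuous_map (prod_topology T (vec_top n)) euclidean (\<lambda>p. snd p $ i)"
  using continuous_map_compose[OF continuous_map_snd continuous_map_vec_index]
  by (simp add: o_def)

text \<open>The origin is a limit point of the punctured complex plane, and continuous maps carry
  closures into closures. Both density proofs exhibit such a curve through a given point.\<close>

lemma in_closure_of_curve:
  fixes \<gamma> :: "complex \<Rightarrow> 'a"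
  assumes "continuous_map euclidean T \<gamma>" and "\<And>e. e \<noteq> 0 \<Longrightarrow> \<gamma> e \<in> S"
  shows "\<gamma> 0 \<in> T closure_of S"
proof -
  have "closure (- {0 :: complex}) = UNIV"
    by (simp add: closure_complement interior_singleton)
  then have "\<gamma> 0 \<in> \<gamma> ` (euclidean closure_of (- {0}))" by simp
  also have "\<dots> \<subseteq> T closure_of (\<gamma> ` (- {0}))"
    by (rule continuous_map_image_closure_subset[OF assms(1)])
  also have "\<dots> \<subseteq> T closure_of S"
    by (rule closure_of_mono) (use assms(2) in auto)
  finally show ?thesis .
qed

text \<open>A continuous left inverse on the image is the inverse homeomorphism. For the Lie chart
  such an inverse is available in closed form.\<close>

lemma embedding_map_left_inverse:
  assumes f: "continuous_map X Y f"
    and g: "continuous_map (subtopology Y (f ` topspace X)) X g"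
    and gf: "\<And>x. x \<in> topspace X \<Longrightarrow> g (f x) = x"
  shows "embedding_map X Y f"
proof -
  have "homeomorphic_maps X (subtopology Y (f ` topspace X)) f g"
    unfolding homeomorphic_maps_def
    using f g gf by (auto simp: continuous_map_in_subtopology)
  then show ?thesis
    unfolding embedding_map_def by (rule homeomorphic_maps_imp_map)
qed

section \<open>The Lie chart\<close>

text \<open>From X X = 0 it follows that \<open>ad X\<close> applied twice to A is -2 X A X and
  applied three times is 0. The series is therefore A + (X A - A X) - X A X, the expansion of the
  product on the right.\<close>

lemma exp_ad_square_zero:
  assumes X: "X \<in> carrier_mat m m" and A: "A \<in> carrier_mat m m" and XX: "X * X = 0\<^sub>m m m"
  shows "exp_ad X A = (1\<^sub>m m + X) * A * (1\<^sub>m m - X)"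
proof -
  define B where "B = X * A * X"
  have XA: "X * A \<in> carrier_mat m m" and AX: "A * X \<in> carrier_mat m m"
    and B: "B \<in> carrier_mat m m"
    using X A by (auto simp: B_def)
  have XXA: "X * (X * A) = 0\<^sub>m m m" and AXX: "A * X * X = 0\<^sub>m m m" and XAX: "X * (A * X) = B"
    using X A XX by (simp_all add: B_def assoc_mult_mat[of _ m m _ m _ m]
      assoc_mult_mat[of X m m X m A m, symmetric])
  have XB: "X * B = 0\<^sub>m m m"
    using X XA by (simp add: B_def assoc_mult_mat[of X m m "X * A" m X m, symmetric] XXA)
  have BX: "B * X = 0\<^sub>m m m"
    using X A XA by (simp add: B_def assoc_mult_mat[OF XA X X] XX del: assoc_mult_mat)
  have ad1: "ad X A = X * A - A * X" by (simp add: ad_def)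
  have ad2: "ad X (ad X A) = - 2 \<cdot>\<^sub>m B"
  proof -
    have "ad X (ad X A) = (0\<^sub>m m m - B) - (B - 0\<^sub>m m m)"
      unfolding ad_def using X A XA AX XXA AXX XAX
      by (simp add: mult_minus_distrib_mat[of _ m m _ m] minus_mult_distrib_mat[of _ m m _ _ m]
        B_def)
    also have "\<dots> = - 2 \<cdot>\<^sub>m B" using B by (intro eq_matI) auto
    finally show ?thesis .
  qed
  have ad0: "ad X (0\<^sub>m m m) = 0\<^sub>m m m"
    using X by (simp add: ad_def)
  have ad3: "ad X (ad X (ad X A)) = 0\<^sub>m m m"
    unfolding ad2 using X B XB BX
    by (simp add: ad_def mult_smult_distrib[of _ m m _ m] mult_smult_assoc_mat[of _ m m _ m])
  \<comment> \<open>Only the powers 0, 1 and 2 survive, so each entrywise series is a finite sum;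
    the 2 in \<open>ad2\<close> cancels against \<open>fact 2\<close>.\<close>
  have tail: "(ad X ^^ (k + 3)) A = 0\<^sub>m m m" for k
    by (induction k) (simp_all add: eval_nat_numeral ad3 ad0)
  have "exp_ad X A = A + X * A - (A * X + B)"
  proof (rule eq_matI)
    fix i j assume "i < dim_row (A + X * A - (A * X + B))" "j < dim_col (A + X * A - (A * X + B))"
    then have ij: "i < m" "j < m" using B by auto
    have "(\<Sum>k. ((ad X ^^ k) A) $$ (i, j) / fact k) = (\<Sum>k<3. ((ad X ^^ k) A) $$ (i, j) / fact k)"
    proof (rule suminf_finite)
      fix k :: nat assume "k \<notin> {..<3}"
      then obtain l where "k = l + 3" by (metis add.commute lessThan_iff less_eqE not_less)
      then show "((ad X ^^ k) A) $$ (i, j) / fact k = 0" using tail ij by simp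
    qed simp
    also have "\<dots> = (A + X * A - (A * X + B)) $$ (i, j)"
      unfolding eval_nat_numeral using ij X A XA AX B
      by (simp add: ad2[unfolded ad1] ad1)
    finally show "exp_ad X A $$ (i, j) = (A + X * A - (A * X + B)) $$ (i, j)"
      using ij A by (simp add: exp_ad_def)
  qed (use A B in \<open>auto simp: exp_ad_def\<close>)
  also have "\<dots> = (1\<^sub>m m + X) * A * (1\<^sub>m m - X)"
    using X A XA AX B
    by (simp add: add_mult_distrib_mat[of _ m m] mult_minus_distrib_mat[of _ m m _ m] B_def)
  finally show ?thesis .
qed

section \<open>Matrices of the form scaled rank one minus identity\<close>

definition rank_one :: "nat \<Rightarrow> complex mat \<Rightarrow> complex mat \<Rightarrow> complex mat" where
  "rank_one n V W = of_nat (n + 1) \<cdot>\<^sub>m (V * W) - 1\<^sub>m (n + 1)"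

lemma rank_one_index:
  assumes "V \<in> carrier_mat (n + 1) 1" "W \<in> carrier_mat 1 (n + 1)" "i \<le> n" "j \<le> n"
  shows "rank_one n V W $$ (i, j) =
    of_nat (n + 1) * (V $$ (i, 0) * W $$ (0, j)) - (if i = j then 1 else 0)"
  using assms by (auto simp: rank_one_def scalar_prod_def)

lemma rank_one_carrier:
  assumes "V \<in> carrier_mat (n + 1) 1" "W \<in> carrier_mat 1 (n + 1)"
  shows "rank_one n V W \<in> carrier_mat (n + 1) (n + 1)"
  using assms by (auto simp: rank_one_def)

text \<open>Conjugation acts on the column and the row separately, and fixes the identity part
  because g h = 1. Keeping V and W as one-column and one-row matrices reduces this to associativity
  of the product.\<close>

lemma conj_rank_one:
  assumes V: "V \<in> carrier_mat (n + 1) 1" and W: "W \<in> carrier_mat 1 (n + 1)"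
    and g: "g \<in> carrier_mat (n + 1) (n + 1)" and h: "h \<in> carrier_mat (n + 1) (n + 1)"
    and gh: "g * h = 1\<^sub>m (n + 1)"
  shows "g * rank_one n V W * h = rank_one n (g * V) (W * h)"
proof -
  have VW: "V * W \<in> carrier_mat (n + 1) (n + 1)" using V W by simp
  have gVW: "g * (V * W) \<in> carrier_mat (n + 1) (n + 1)" using VW g by simp
  have "g * rank_one n V W * h = of_nat (n + 1) \<cdot>\<^sub>m (g * (V * W)) * h - g * h"
    unfolding rank_one_def using VW g h gVW
    by (simp add: mult_minus_distrib_mat[of _ "n + 1" "n + 1" _ "n + 1"]
        mult_smult_distrib[of _ "n + 1" "n + 1" _ "n + 1"]
        minus_mult_distrib_mat[of _ "n + 1" "n + 1" _ _ "n + 1"])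
  also have "of_nat (n + 1) \<cdot>\<^sub>m (g * (V * W)) * h = of_nat (n + 1) \<cdot>\<^sub>m (g * (V * W) * h)"
    by (rule mult_smult_assoc_mat[OF gVW h])
  also have "g * (V * W) * h = g * V * (W * h)"
    using assoc_mult_mat[OF g V W] assoc_mult_mat[OF mult_carrier_mat[OF g V] W h] by simp
  finally show ?thesis by (simp add: gh rank_one_def)
qed

text \<open>The diagonal is (n + 1) - 1 = n in position 0 and 0 - 1 elsewhere, so both factors are
  the first unit vector.\<close>

lemma min_diag_rank_one:
  "min_diag n = rank_one n (mat (n + 1) 1 (\<lambda>(i, j). if i = 0 then 1 else 0))
    (mat 1 (n + 1) (\<lambda>(i, j). if j = 0 then 1 else 0))"
  by (rule eq_matI) (auto simp: min_diag_def mat_diag_def rank_one_def scalar_prod_def)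

section \<open>The square-zero matrices X and Y and the chart as a conjugation\<close>

lemma X_mat_carrier: "x \<in> carrier_vec n \<Longrightarrow> X_mat n x \<in> carrier_mat (n + 1) (n + 1)"
  by (auto simp: X_mat_def)

lemma Y_mat_carrier: "y \<in> carrier_vec n \<Longrightarrow> Y_mat n y \<in> carrier_mat (n + 1) (n + 1)"
  by (auto simp: Y_mat_def)

lemma X_mat_index:
  assumes "x \<in> carrier_vec n" "i \<le> n" "j \<le> n"
  shows "X_mat n x $$ (i, j) = (case j of 0 \<Rightarrow> 0 | Suc k \<Rightarrow> if i = 0 then x $ k else 0)"
  using assms by (auto simp: X_mat_def split: nat.splits)

lemma Y_mat_index:
  assumes "y \<in> carrier_vec n" "i \<le> n" "j \<le> n"
  shows "Y_mat n y $$ (i, j) = (case i of 0 \<Rightarrow> 0 | Suc k \<Rightarrow> if j = 0 then y $ k else 0)"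
  using assms by (auto simp: Y_mat_def split: nat.splits)

lemma X_mat_square: "x \<in> carrier_vec n \<Longrightarrow> X_mat n x * X_mat n x = 0\<^sub>m (n + 1) (n + 1)"
  using X_mat_carrier[of x n]
  by (intro eq_matI) (auto simp: scalar_prod_def X_mat_index intro!: sum.neutral split: nat.splits)

lemma Y_mat_square: "y \<in> carrier_vec n \<Longrightarrow> Y_mat n y * Y_mat n y = 0\<^sub>m (n + 1) (n + 1)"
  using Y_mat_carrier[of y n]
  by (intro eq_matI) (auto simp: scalar_prod_def Y_mat_index intro!: sum.neutral split: nat.splits)

text \<open>The product is 1 - X X. It identifies the closed form of \<open>exp_ad\<close> as
  conjugation by 1 + X.\<close>

lemma one_plus_mult_one_minus:
  assumes X: "(X :: complex mat) \<in> carrier_mat m m" and XX: "X * X = 0\<^sub>m m m"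
  shows "(1\<^sub>m m + X) * (1\<^sub>m m - X) = 1\<^sub>m m"
proof -
  have "(1\<^sub>m m + X) * (1\<^sub>m m - X) = 1\<^sub>m m + X - (X + X * X)"
    using X by (simp add: add_mult_distrib_mat[of _ m m] mult_minus_distrib_mat[of _ m m _ m])
  also have "\<dots> = 1\<^sub>m m" unfolding XX using X by (intro eq_matI) auto
  finally show ?thesis .
qed

definition chart_col :: "nat \<Rightarrow> complex vec \<Rightarrow> complex mat" where
  "chart_col n y = mat (n + 1) 1 (\<lambda>(i, j). if i = 0 then 1 else y $ (i - 1))"

text \<open>The row pairs with \<open>chart_col n y\<close> to (1 + x \<bullet> y) - x \<bullet> y =
  1, the normalisation shared by all points of the orbit.\<close>

definition chart_row :: "nat \<Rightarrow> complex vec \<Rightarrow> complex vec \<Rightarrow> complex mat" where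
  "chart_row n x y = mat 1 (n + 1) (\<lambda>(i, j). if j = 0 then 1 + x \<bullet> y else - x $ (j - 1))"

lemma chart_col_carrier: "chart_col n y \<in> carrier_mat (n + 1) 1"
  by (simp add: chart_col_def)

lemma chart_row_carrier: "chart_row n x y \<in> carrier_mat 1 (n + 1)"
  by (simp add: chart_row_def)

lemma lie_chart_conj:
  assumes x: "x \<in> carrier_vec n" and y: "y \<in> carrier_vec n"
  shows "lie_chart n (min_diag n) (x, y) =
    (1\<^sub>m (n + 1) + Y_mat n y) * ((1\<^sub>m (n + 1) + X_mat n x) * min_diag n * (1\<^sub>m (n + 1) - X_mat n x))
      * (1\<^sub>m (n + 1) - Y_mat n y)"
proof -
  have H: "min_diag n \<in> carrier_mat (n + 1) (n + 1)" by (simp add: min_diag_def)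
  note X = X_mat_carrier[OF x] and Y = Y_mat_carrier[OF y]
  have "(1\<^sub>m (n + 1) + X_mat n x) * min_diag n * (1\<^sub>m (n + 1) - X_mat n x) \<in> carrier_mat (n + 1) (n + 1)"
    using H X by (intro mult_carrier_mat[of _ _ "n + 1"] minus_carrier_mat add_carrier_mat one_carrier_mat)
  then show ?thesis
    unfolding lie_chart_def prod.case exp_ad_square_zero[OF X H X_mat_square[OF x]]
    by (rule exp_ad_square_zero[OF Y _ Y_mat_square[OF y]])
qed

text \<open>The two conjugations are followed on the unit vectors. The column is fixed by 1 + X and
  sent to (1, y) by 1 + Y; the row becomes (1, -x) under 1 - X and then (1 + x \<bullet> y, -x)
  under 1 - Y.\<close>

lemma lie_chart_eq:
  assumes x: "x \<in> carrier_vec n" and y: "y \<in> carrier_vec n"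
  shows "lie_chart n (min_diag n) (x, y) = rank_one n (chart_col n y) (chart_row n x y)"
proof -
  let ?e = "mat (n + 1) 1 (\<lambda>(i, j). if i = 0 then 1 else 0) :: complex mat"
  let ?f = "mat 1 (n + 1) (\<lambda>(i, j). if j = 0 then 1 else 0) :: complex mat"
  let ?f' = "mat 1 (n + 1) (\<lambda>(i, j). if j = 0 then 1 else - x $ (j - 1)) :: complex mat"
  note X = X_mat_carrier[OF x] and Y = Y_mat_carrier[OF y]
  have 1: "(1\<^sub>m (n + 1) + X_mat n x) * ?e = ?e"
    using X by (intro eq_matI)
      (auto simp: scalar_prod_def X_mat_index[OF x]
        sum.atLeast0_lessThan_Suc_shift simp del: sum.op_ivl_Suc intro!: sum.neutral split: nat.splits)
  have 2: "?f * (1\<^sub>m (n + 1) - X_mat n x) = ?f'"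
    using X by (intro eq_matI)
      (auto simp: scalar_prod_def X_mat_index[OF x]
        sum.atLeast0_lessThan_Suc_shift simp del: sum.op_ivl_Suc intro!: sum.neutral split: nat.splits)
  have 3: "(1\<^sub>m (n + 1) + Y_mat n y) * ?e = chart_col n y"
    using Y by (intro eq_matI)
      (auto simp: scalar_prod_def Y_mat_index[OF y] chart_col_def
        sum.atLeast0_lessThan_Suc_shift simp del: sum.op_ivl_Suc intro!: sum.neutral split: nat.splits)
  have 4: "?f' * (1\<^sub>m (n + 1) - Y_mat n y) = chart_row n x y" (is "?L = ?R")
  proof (rule eq_matI)
    fix i j assume "i < dim_row ?R" "j < dim_col ?R"
    then have i: "i = 0" and j: "j \<le> n" by (auto simp: chart_row_def)
    \<comment> \<open>Row index 0 of 1 - Y is split off. In column 0 the remaining sum is x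
      \<bullet> y; in a later column the identity part selects a single entry of -x.\<close>
    have "?L $$ (i, j) = (if j = 0 then 1 else 0) +
        (\<Sum>k<n. - x $ k * ((if Suc k = j then 1 else 0) - (if j = 0 then y $ k else 0)))"
      using i j Y by (simp add: scalar_prod_def Y_mat_index[OF y] sum.atLeast0_lessThan_Suc_shift
        atLeast0LessThan[symmetric] del: sum.op_ivl_Suc cong: if_cong)
    also have "\<dots> = ?R $$ (i, j)"
    proof (cases j)
      case 0
      then show ?thesis using i y
        by (simp add: chart_row_def scalar_prod_def atLeast0LessThan)
    next
      case (Suc l)
      then show ?thesis using i j
        by (simp add: chart_row_def if_distrib[where f = "\<lambda>t. _ * t"] sum_negf cong: if_cong)
    qed
    finally show "?L $$ (i, j) = ?R $$ (i, j)" .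
  qed (use Y in \<open>auto simp: chart_row_def\<close>)
  have 5: "(1\<^sub>m (n + 1) + X_mat n x) * min_diag n * (1\<^sub>m (n + 1) - X_mat n x) = rank_one n ?e ?f'"
    unfolding min_diag_rank_one
    by (subst conj_rank_one)
      (use X 1 2 one_plus_mult_one_minus[OF X X_mat_square[OF x]] in \<open>simp_all add: minus_carrier_mat\<close>)
  have "lie_chart n (min_diag n) (x, y) =
      (1\<^sub>m (n + 1) + Y_mat n y) * rank_one n ?e ?f' * (1\<^sub>m (n + 1) - Y_mat n y)"
    unfolding lie_chart_conj[OF x y] 5 ..
  also have "\<dots> = rank_one n (chart_col n y) (chart_row n x y)"
    by (subst conj_rank_one)
      (use Y 3 4 one_plus_mult_one_minus[OF Y Y_mat_square[OF y]] in \<open>simp_all add: minus_carrier_mat\<close>)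
  finally show ?thesis .
qed

text \<open>The product V W is unchanged when V is divided and W multiplied by the same nonzero
  scalar. Taking that scalar to be the first entry of V makes the column (1, y), and x is read off
  the rescaled row.\<close>

lemma rank_one_mem_lie_chart:
  assumes V: "V \<in> carrier_mat (n + 1) 1" and W: "W \<in> carrier_mat 1 (n + 1)"
    and WV: "(\<Sum>k<Suc n. W $$ (0, k) * V $$ (k, 0)) = 1" and V0: "V $$ (0, 0) \<noteq> 0"
  shows "rank_one n V W \<in> lie_chart n (min_diag n) ` (carrier_vec n \<times> carrier_vec n)"
proof -
  define x where "x = vec n (\<lambda>k. - V $$ (0, 0) * W $$ (0, Suc k))"
  define y where "y = vec n (\<lambda>k. V $$ (Suc k, 0) / V $$ (0, 0))"
  have x: "x \<in> carrier_vec n" and y: "y \<in> carrier_vec n" by (auto simp: x_def y_def)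
  have "x \<bullet> y = - (\<Sum>k<n. W $$ (0, Suc k) * V $$ (Suc k, 0))"
    using V0 by (simp add: scalar_prod_def x_def y_def atLeast0LessThan sum_negf)
  \<comment> \<open>The normalisation of the pairing fixes the remaining entry of the row: splitting
    off k = 0 expresses the rest of the sum through the first entries.\<close>
  also have "\<dots> = V $$ (0, 0) * W $$ (0, 0) - 1"
    using WV by (simp add: sum.lessThan_Suc_shift algebra_simps del: sum.lessThan_Suc)
  finally have xy: "1 + x \<bullet> y = V $$ (0, 0) * W $$ (0, 0)" by simp
  have col: "chart_col n y $$ (i, 0) = V $$ (i, 0) / V $$ (0, 0)" if "i \<le> n" for i
    using that V0 by (cases i) (auto simp: chart_col_def y_def)
  have row: "chart_row n x y $$ (0, j) = V $$ (0, 0) * W $$ (0, j)" if "j \<le> n" for j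
    using that by (cases j) (auto simp: chart_row_def xy, auto simp: x_def)
  have "lie_chart n (min_diag n) (x, y) = rank_one n V W"
    unfolding lie_chart_eq[OF x y]
  proof (rule eq_matI)
    fix i j assume "i < dim_row (rank_one n V W)" "j < dim_col (rank_one n V W)"
    then have "i \<le> n" "j \<le> n" using V W by (auto simp: rank_one_def)
    then show "rank_one n (chart_col n y) (chart_row n x y) $$ (i, j) = rank_one n V W $$ (i, j)"
      using V0 by (simp add: rank_one_index[OF V W] rank_one_index[OF chart_col_carrier chart_row_carrier] col row)
  qed (auto simp: rank_one_def)
  then show ?thesis using x y by (metis SigmaI image_eqI)
qed

text \<open>For A = g H h the factors are the first column of g and the first row of h. Their
  pairing is the (0, 0) entry of h g = 1.\<close>

lemma adjoint_orbit_rank_one: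
  assumes "A \<in> adjoint_orbit (n + 1) (min_diag n)"
  obtains V W where "V \<in> carrier_mat (n + 1) 1" "W \<in> carrier_mat 1 (n + 1)"
    "A = rank_one n V W" "(\<Sum>k<Suc n. W $$ (0, k) * V $$ (k, 0)) = 1"
proof -
  let ?e = "mat (n + 1) 1 (\<lambda>(i, j). if i = 0 then 1 else 0) :: complex mat"
  let ?f = "mat 1 (n + 1) (\<lambda>(i, j). if j = 0 then 1 else 0) :: complex mat"
  have e: "?e \<in> carrier_mat (n + 1) 1" and f: "?f \<in> carrier_mat 1 (n + 1)" by auto
  obtain g h where g: "g \<in> carrier_mat (n + 1) (n + 1)" and h: "h \<in> carrier_mat (n + 1) (n + 1)"
    and gh: "g * h = 1\<^sub>m (n + 1)" and A: "A = g * min_diag n * h"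
    using assms by (auto simp: adjoint_orbit_def SL_def inverts_mat_def)
  \<comment> \<open>The orbit supplies h as a right inverse of g, while the pairing involves the
    product in the other order.\<close>
  have hg: "h * g = 1\<^sub>m (n + 1)" by (rule mat_mult_left_right_inverse[OF g h gh])
  have ge: "g * ?e \<in> carrier_mat (n + 1) 1" and fh: "?f * h \<in> carrier_mat 1 (n + 1)"
    using g h by auto
  have "?f * h * (g * ?e) = ?f * (h * g * ?e)"
    using assoc_mult_mat[OF f h ge] assoc_mult_mat[OF h g e] by simp
  also have "\<dots> = ?f * ?e" unfolding hg by simp
  finally have "(?f * h * (g * ?e)) $$ (0, 0) = (?f * ?e) $$ (0, 0)" by simp
  also have "\<dots> = 1"
    by (simp add: scalar_prod_def sum.atLeast0_lessThan_Suc_shift del: sum.op_ivl_Suc)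
  also have "(?f * h * (g * ?e)) $$ (0, 0) =
      (\<Sum>k<Suc n. (?f * h) $$ (0, k) * (g * ?e) $$ (k, 0))"
    using fh ge by (subst index_mult_mat)
      (auto simp: scalar_prod_def atLeast0LessThan simp del: index_mult_mat(1) sum.lessThan_Suc intro!: sum.cong)
  finally show thesis
    using that[OF ge fh] A conj_rank_one[OF e f g h gh] min_diag_rank_one[of n] by simp
qed

text \<open>The conjugating matrix is (1 + Y)(1 + X), a product of a lower and an upper
  unitriangular matrix, so its determinant is 1. Its inverse is (1 - X)(1 - Y).\<close>

lemma lie_chart_mem_adjoint_orbit:
  assumes x: "x \<in> carrier_vec n" and y: "y \<in> carrier_vec n"
  shows "lie_chart n (min_diag n) (x, y) \<in> adjoint_orbit (n + 1) (min_diag n)"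
proof -
  let ?X = "X_mat n x" and ?Y = "Y_mat n y" and ?m = "n + 1"
  let ?g = "(1\<^sub>m ?m + ?Y) * (1\<^sub>m ?m + ?X)" and ?h = "(1\<^sub>m ?m - ?X) * (1\<^sub>m ?m - ?Y)"
  note X = X_mat_carrier[OF x] and Y = Y_mat_carrier[OF y]
  have H: "min_diag n \<in> carrier_mat ?m ?m" by (simp add: min_diag_def)
  have c: "1\<^sub>m ?m + ?Y \<in> carrier_mat ?m ?m" "1\<^sub>m ?m + ?X \<in> carrier_mat ?m ?m"
    "1\<^sub>m ?m - ?X \<in> carrier_mat ?m ?m" "1\<^sub>m ?m - ?Y \<in> carrier_mat ?m ?m"
    using X Y by (simp_all add: minus_carrier_mat)
  have "det (1\<^sub>m ?m + ?X) = prod_list (diag_mat (1\<^sub>m ?m + ?X))"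
    by (rule det_upper_triangular[OF _ c(2)])
       (use X in \<open>auto simp: X_mat_index[OF x] split: nat.splits\<close>)
  also have "\<dots> = 1"
    unfolding prod_list_diag_prod using X
    by (intro prod.neutral) (auto simp: X_mat_index[OF x] split: nat.splits)
  finally have dX: "det (1\<^sub>m ?m + ?X) = 1" .
  have "det (1\<^sub>m ?m + ?Y) = prod_list (diag_mat (1\<^sub>m ?m + ?Y))"
    by (rule det_lower_triangular[OF _ c(1)])
       (use Y in \<open>auto simp: Y_mat_index[OF y] split: nat.splits\<close>)
  also have "\<dots> = 1"
    unfolding prod_list_diag_prod using Y
    by (intro prod.neutral) (auto simp: Y_mat_index[OF y] split: nat.splits)
  finally have dY: "det (1\<^sub>m ?m + ?Y) = 1" .
  have g: "?g \<in> SL ?m" unfolding SL_def using det_mult[OF c(1) c(2)] c(1,2) dX dY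
    by (auto intro: mult_carrier_mat)
  have h: "?h \<in> carrier_mat ?m ?m" using c by (auto intro: mult_carrier_mat)
  have "?g * ?h = (1\<^sub>m ?m + ?Y) * ((1\<^sub>m ?m + ?X) * (1\<^sub>m ?m - ?X) * (1\<^sub>m ?m - ?Y))"
    using assoc_mult_mat[OF c(1,2) h] assoc_mult_mat[OF c(2,3,4)] by simp
  also have "\<dots> = 1\<^sub>m ?m"
    using one_plus_mult_one_minus[OF X X_mat_square[OF x]]
      one_plus_mult_one_minus[OF Y Y_mat_square[OF y]] left_mult_one_mat[OF c(4)] by (simp only:)
  finally have gh: "inverts_mat ?g ?h"
    using Y by (simp add: inverts_mat_def)
  note XH = mult_carrier_mat[OF c(2) H]
  have "lie_chart n (min_diag n) (x, y) = ?g * min_diag n * ?h"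
    unfolding lie_chart_conj[OF x y]
    using assoc_mult_mat[OF c(1) XH c(3)] assoc_mult_mat[OF c(1,2) H]
      assoc_mult_mat[OF mult_carrier_mat[OF mult_carrier_mat[OF c(1,2)] H] c(3,4)] by simp
  then show ?thesis unfolding adjoint_orbit_def using g h gh by blast
qed

section \<open>Recovering the coordinates from a point of the orbit\<close>

definition shifted :: "complex mat \<Rightarrow> nat \<Rightarrow> nat \<Rightarrow> complex" where
  "shifted A i j = A $$ (i, j) + (if i = j then 1 else 0)"

text \<open>This is the squared Hermitian norm of row 0 of A + 1, kept complex so that it can divide
  complex entries. On the orbit A + 1 = (n + 1) V W with W nonzero, so it vanishes exactly when the
  first entry of V does.\<close>

definition row_norm :: "nat \<Rightarrow> complex mat \<Rightarrow> complex" where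
  "row_norm n A = (\<Sum>j<Suc n. shifted A 0 j * cnj (shifted A 0 j))"

text \<open>On the chart, row 0 of A + 1 is (n + 1)(1 + x \<bullet> y, -x) and row k + 1 is y $ k
  times row 0. Taking the Hermitian product with row 0 recovers y by one continuous formula, with no
  choice of a nonzero entry.\<close>

definition orbit_coords :: "nat \<Rightarrow> complex mat \<Rightarrow> complex vec \<times> complex vec" where
  "orbit_coords n A =
    (vec n (\<lambda>k. - shifted A 0 (Suc k) / of_nat (Suc n)),
     vec n (\<lambda>k. (\<Sum>j<Suc n. shifted A (Suc k) j * cnj (shifted A 0 j)) / row_norm n A))"

lemma row_norm_eq_0_iff: "row_norm n A = 0 \<longleftrightarrow> (\<forall>j\<le>n. shifted A 0 j = 0)"
proof -
  have "row_norm n A = of_real (\<Sum>j<Suc n. (cmod (shifted A 0 j))\<^sup>2)"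
    unfolding row_norm_def of_real_sum by (simp only: complex_norm_square)
  then have "row_norm n A = 0 \<longleftrightarrow> (\<Sum>j<Suc n. (cmod (shifted A 0 j))\<^sup>2) = 0"
    by (simp only: of_real_eq_0_iff)
  also have "\<dots> \<longleftrightarrow> (\<forall>j\<in>{..<Suc n}. (cmod (shifted A 0 j))\<^sup>2 = 0)"
    by (intro sum_nonneg_eq_0_iff) auto
  finally show ?thesis by (auto simp: less_Suc_eq_le)
qed

lemma shifted_rank_one:
  assumes "V \<in> carrier_mat (n + 1) 1" "W \<in> carrier_mat 1 (n + 1)" "i \<le> n" "j \<le> n"
  shows "shifted (rank_one n V W) i j = of_nat (Suc n) * (V $$ (i, 0) * W $$ (0, j))"
  unfolding shifted_def rank_one_index[OF assms] by simp

lemma shifted_lie_chart: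
  assumes "x \<in> carrier_vec n" "y \<in> carrier_vec n" "i \<le> n" "j \<le> n"
  shows "shifted (lie_chart n (min_diag n) (x, y)) i j =
    of_nat (Suc n) * (chart_col n y $$ (i, 0) * chart_row n x y $$ (0, j))"
  unfolding lie_chart_eq[OF assms(1,2)]
  by (rule shifted_rank_one[OF chart_col_carrier chart_row_carrier assms(3,4)])

text \<open>If the row (1 + x \<bullet> y, -x) vanished, then x = 0, and its first entry would be
  1.\<close>

lemma row_norm_lie_chart:
  assumes x: "x \<in> carrier_vec n" and y: "y \<in> carrier_vec n"
  shows "row_norm n (lie_chart n (min_diag n) (x, y)) \<noteq> 0"
proof
  assume "row_norm n (lie_chart n (min_diag n) (x, y)) = 0"
  then have row: "chart_row n x y $$ (0, j) = 0" if "j \<le> n" for j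
    using that shifted_lie_chart[OF x y _ that, of 0]
    by (simp add: row_norm_eq_0_iff chart_col_def del: of_nat_Suc)
  then have "x $ k = 0" if "k < n" for k
    using that row[of "Suc k"] by (simp add: chart_row_def)
  then have "x \<bullet> y = 0" using y by (simp add: scalar_prod_def)
  then show False using row[of 0] by (simp add: chart_row_def)
qed

lemma orbit_coords_lie_chart:
  assumes x: "x \<in> carrier_vec n" and y: "y \<in> carrier_vec n"
  shows "orbit_coords n (lie_chart n (min_diag n) (x, y)) = (x, y)"
proof -
  let ?A = "lie_chart n (min_diag n) (x, y)"
  have 1: "shifted ?A 0 (Suc k) = of_nat (Suc n) * (- x $ k)" if "k < n" for k
    using that by (subst shifted_lie_chart[OF x y]) (auto simp: chart_col_def chart_row_def)
  have "shifted ?A (Suc k) j = y $ k * shifted ?A 0 j" if "k < n" "j \<le> n" for k j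
    using that by (simp add: shifted_lie_chart[OF x y]) (simp add: chart_col_def)
  then have 2: "(\<Sum>j<Suc n. shifted ?A (Suc k) j * cnj (shifted ?A 0 j)) = y $ k * row_norm n ?A"
    if "k < n" for k
    unfolding row_norm_def sum_distrib_left using that by (intro sum.cong) auto
  show ?thesis
    unfolding orbit_coords_def prod.inject
  proof (intro conjI)
    show "vec n (\<lambda>k. - shifted ?A 0 (Suc k) / of_nat (Suc n)) = x"
      using x by (intro eq_vecI) (auto simp: 1 simp del: of_nat_Suc)
    show "vec n (\<lambda>k. (\<Sum>j<Suc n. shifted ?A (Suc k) j * cnj (shifted ?A 0 j)) / row_norm n ?A) = y"
      using y row_norm_lie_chart[OF x y] 2
      by (intro eq_vecI) (auto simp del: sum.lessThan_Suc)
  qed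
qed

text \<open>Describing the image as the locus where a continuous function does not vanish makes its
  openness in the orbit immediate.\<close>

lemma lie_chart_image:
  "lie_chart n (min_diag n) ` (carrier_vec n \<times> carrier_vec n) =
    {A \<in> adjoint_orbit (n + 1) (min_diag n). row_norm n A \<noteq> 0}" (is "?L = ?R")
proof
  show "?L \<subseteq> ?R"
    using lie_chart_mem_adjoint_orbit row_norm_lie_chart by auto
  show "?R \<subseteq> ?L"
  proof
    fix A assume "A \<in> ?R"
    then have A: "A \<in> adjoint_orbit (n + 1) (min_diag n)" and ne: "row_norm n A \<noteq> 0" by auto
    obtain V W where VW: "V \<in> carrier_mat (n + 1) 1" "W \<in> carrier_mat 1 (n + 1)"
      and eq: "A = rank_one n V W" and 1: "(\<Sum>k<Suc n. W $$ (0, k) * V $$ (k, 0)) = 1"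
      using adjoint_orbit_rank_one[OF A] .
    \<comment> \<open>Row 0 of A + 1 is (n + 1) times the first entry of V times W.\<close>
    have "V $$ (0, 0) \<noteq> 0"
      using ne shifted_rank_one[OF VW, of 0] by (auto simp: row_norm_eq_0_iff eq)
    then show "A \<in> ?L" unfolding eq by (intro rank_one_mem_lie_chart VW 1)
  qed
qed

section \<open>Continuity of the Lie chart and of its inverse\<close>

lemma continuous_map_rank_one:
  assumes VW: "\<And>t. V t \<in> carrier_mat (n + 1) 1" "\<And>t. W t \<in> carrier_mat 1 (n + 1)"
    and V: "\<And>i. i \<le> n \<Longrightarrow> continuous_map T euclidean (\<lambda>t. V t $$ (i, 0))"
    and W: "\<And>j. j \<le> n \<Longrightarrow> continuous_map T euclidean (\<lambda>t. W t $$ (0, j))"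
  shows "continuous_map T (mat_top (n + 1)) (\<lambda>t. rank_one n (V t) (W t))"
proof (rule continuous_map_mat_top)
  fix i j assume "i < n + 1" "j < n + 1"
  then show "continuous_map T euclidean (\<lambda>t. rank_one n (V t) (W t) $$ (i, j))"
    by (subst rank_one_index[OF VW])
       (auto intro!: continuous_map_diff continuous_map_mult_algebra V W)
qed (rule rank_one_carrier[OF VW])

lemma adjoint_orbit_carrier:
  "A \<in> adjoint_orbit (n + 1) (min_diag n) \<Longrightarrow> A \<in> carrier_mat (n + 1) (n + 1)"
  by (erule adjoint_orbit_rank_one) (simp only: rank_one_carrier)

lemma topspace_orbit_top: "topspace (orbit_top n (min_diag n)) = adjoint_orbit (n + 1) (min_diag n)"
  using adjoint_orbit_carrier by (auto simp: orbit_top_def)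

lemma continuous_map_lie_chart:
  "continuous_map (coord_top n) (orbit_top n (min_diag n)) (lie_chart n (min_diag n))"
proof -
  have "continuous_map (coord_top n) (mat_top (n + 1))
    (\<lambda>p. rank_one n (chart_col n (snd p)) (chart_row n (fst p) (snd p)))"
  proof (rule continuous_map_rank_one)
    fix i assume "i \<le> n"
    then show "continuous_map (coord_top n) euclidean (\<lambda>p. chart_col n (snd p) $$ (i, 0))"
      by (cases i) (auto simp: chart_col_def intro!: continuous_map_snd_index)
  next
    fix j assume "j \<le> n"
    show "continuous_map (coord_top n) euclidean (\<lambda>p. chart_row n (fst p) (snd p) $$ (0, j))"
    proof (cases j)
      case 0
      have "continuous_map (coord_top n) euclidean (\<lambda>p. 1 + (\<Sum>k<n. fst p $ k * snd p $ k))"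
        by (intro continuous_map_add continuous_map_sum continuous_map_mult_algebra
            continuous_map_fst_index continuous_map_snd_index) auto
      then show ?thesis
        by (rule continuous_map_eq) (auto simp: 0 chart_row_def scalar_prod_def atLeast0LessThan)
    next
      case (Suc k)
      then show ?thesis using \<open>j \<le> n\<close>
        by (auto simp: chart_row_def intro!: continuous_map_minus continuous_map_fst_index)
    qed
  qed (auto simp: chart_col_carrier[simplified] chart_row_carrier[simplified])
  then have "continuous_map (coord_top n) (mat_top (n + 1)) (lie_chart n (min_diag n))"
    by (rule continuous_map_eq) (auto simp: lie_chart_eq)
  then show ?thesis
    by (auto simp: orbit_top_def continuous_map_in_subtopology lie_chart_mem_adjoint_orbit[simplified])
qed

lemma continuous_map_shifted:
  assumes "i \<le> n" "j \<le> n"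
  shows "continuous_map (mat_top (n + 1)) euclidean (\<lambda>A. shifted A i j)"
  unfolding shifted_def using assms
  by (intro continuous_map_add continuous_map_mat_index) auto

lemma continuous_map_row_norm: "continuous_map (mat_top (n + 1)) euclidean (row_norm n)"
  unfolding row_norm_def[abs_def]
  by (intro continuous_map_sum continuous_map_mult_algebra continuous_map_cnj continuous_map_shifted) auto

lemma continuous_map_orbit_coords:
  assumes "\<And>A. A \<in> S \<Longrightarrow> row_norm n A \<noteq> 0"
  shows "continuous_map (subtopology (mat_top (n + 1)) S) (coord_top n) (orbit_coords n)"
proof -
  let ?T = "subtopology (mat_top (n + 1)) S"
  have s: "continuous_map ?T euclidean (\<lambda>A. shifted A i j)" if "i < Suc n" "j < Suc n" for i j
    using that unfolding less_Suc_eq_le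
    by (intro continuous_map_from_subtopology continuous_map_shifted)
  have r: "continuous_map ?T euclidean (row_norm n)"
    by (intro continuous_map_from_subtopology continuous_map_row_norm)
  show ?thesis
    unfolding orbit_coords_def[abs_def]
  proof (intro continuous_map_pairedI continuous_map_vec_top)
    fix i assume i: "i < n"
    show "continuous_map ?T euclidean (\<lambda>A. vec n (\<lambda>k. - shifted A 0 (Suc k) / of_nat (Suc n)) $ i)"
      unfolding index_vec[OF i] using i
      by (intro continuous_map_divide_field continuous_map_minus s continuous_map_const[THEN iffD2])
         (auto simp del: of_nat_Suc)
    show "continuous_map ?T euclidean (\<lambda>A. vec n (\<lambda>k. (\<Sum>j<Suc n. shifted A (Suc k) j *
        cnj (shifted A 0 j)) / row_norm n A) $ i)"
      unfolding index_vec[OF i]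
    proof (rule continuous_map_divide_field[OF _ r])
      show "continuous_map ?T euclidean
          (\<lambda>A. \<Sum>j<Suc n. shifted A (Suc i) j * cnj (shifted A 0 j))"
        using i by (intro continuous_map_sum continuous_map_mult_algebra continuous_map_cnj s) auto
    qed (use assms in auto)
  qed auto
qed

section \<open>Density and openness of the image of the Lie chart\<close>

lemma lie_chart_dense:
  assumes A: "A \<in> adjoint_orbit (n + 1) (min_diag n)"
  shows "A \<in> orbit_top n (min_diag n) closure_of
    (lie_chart n (min_diag n) ` (carrier_vec n \<times> carrier_vec n))" (is "_ \<in> _ closure_of ?S")
proof -
  obtain V W where V: "V \<in> carrier_mat (n + 1) 1" and W: "W \<in> carrier_mat 1 (n + 1)"
    and eq: "A = rank_one n V W" and WV: "(\<Sum>k<Suc n. W $$ (0, k) * V $$ (k, 0)) = 1"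
    using adjoint_orbit_rank_one[OF A] .
  show ?thesis
  proof (cases "V $$ (0, 0) = 0")
    case False
    then have "A \<in> ?S" unfolding eq by (intro rank_one_mem_lie_chart V W WV)
    moreover have "?S \<subseteq> topspace (orbit_top n (min_diag n))"
      unfolding topspace_orbit_top lie_chart_image by auto
    ultimately show ?thesis using closure_of_subset by blast
  next
    case True
    \<comment> \<open>A pairing equal to 1 forces some entry of V to be nonzero.\<close>
    obtain l where l: "l \<le> n" "V $$ (l, 0) \<noteq> 0"
      using WV by (metis (no_types, lifting) lessThan_Suc_atMost atMost_iff mult_zero_right
          sum.neutral zero_neq_one)
    then have l0: "l \<noteq> 0" using True by (cases l) auto
    \<comment> \<open>The new first entry of the column adds e W_0 V_l to the pairing; lowering
      entry l of the row by e W_0 removes the same amount, since entry l of the column is still V_l.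
      As l is not 0, the two changes do not interact.\<close>
    define V' where "V' e = mat (n + 1) 1 (\<lambda>(i, j). if i = 0 then e * V $$ (l, 0) else V $$ (i, 0))" for e
    define W' where "W' e = mat 1 (n + 1)
      (\<lambda>(i, j). W $$ (0, j) - (if j = l then e * W $$ (0, 0) else 0))" for e
    define \<gamma> where "\<gamma> e = rank_one n (V' e) (W' e)" for e
    have VW': "V' e \<in> carrier_mat (n + 1) 1" "W' e \<in> carrier_mat 1 (n + 1)" for e
      by (auto simp: V'_def W'_def)
    have "(\<Sum>k<Suc n. W' e $$ (0, k) * V' e $$ (k, 0)) = 1" for e
    proof -
      have "(\<Sum>k<Suc n. W' e $$ (0, k) * V' e $$ (k, 0)) = (\<Sum>k<Suc n. W $$ (0, k) * V $$ (k, 0) +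
          (if k = 0 then e * W $$ (0, 0) * V $$ (l, 0) else 0) -
          (if k = l then e * W $$ (0, 0) * V $$ (l, 0) else 0))"
        using True l l0 by (intro sum.cong) (auto simp: V'_def W'_def algebra_simps)
      also have "\<dots> = 1"
        unfolding sum_subtractf sum.distrib WV using l by (simp del: sum.lessThan_Suc)
      finally show ?thesis .
    qed
    then have \<gamma>S: "\<gamma> e \<in> ?S" if "e \<noteq> 0" for e
      unfolding \<gamma>_def using that l by (intro rank_one_mem_lie_chart VW') (auto simp: V'_def)
    have \<gamma>0: "\<gamma> 0 = A"
    proof -
      have "V' 0 = V" "W' 0 = W" using V W True by (auto simp: V'_def W'_def)
      then show ?thesis by (simp add: \<gamma>_def eq)
    qed
    have "continuous_map euclidean (mat_top (n + 1)) \<gamma>"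
      unfolding \<gamma>_def[abs_def]
    proof (rule continuous_map_rank_one[OF VW'])
      fix i assume "i \<le> n"
      then show "continuous_map euclidean euclidean (\<lambda>e. V' e $$ (i, 0))"
        "continuous_map euclidean euclidean (\<lambda>e. W' e $$ (0, i))"
        by (cases "i = 0"; cases "i = l"; simp add: V'_def W'_def; intro continuous_intros)+
    qed
    \<comment> \<open>At e = 0 the curve is at A, which lies in the orbit by assumption; elsewhere
      it lies in the image of the chart.\<close>
    moreover have "\<gamma> e \<in> adjoint_orbit (n + 1) (min_diag n)" for e
      using \<gamma>0 \<gamma>S[of e] A unfolding lie_chart_image by (cases "e = 0") auto
    ultimately have "continuous_map euclidean (orbit_top n (min_diag n)) \<gamma>"
      by (auto simp: orbit_top_def continuous_map_in_subtopology)
    from in_closure_of_curve[OF this \<gamma>S] show ?thesis unfolding \<gamma>0 .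
  qed
qed

lemma dense_open_chart_lie_chart:
  "dense_open_chart (coord_top n) (orbit_top n (min_diag n)) (lie_chart n (min_diag n))"
proof -
  let ?M = "orbit_top n (min_diag n)" and ?\<phi> = "lie_chart n (min_diag n)"
  let ?S = "?\<phi> ` (carrier_vec n \<times> carrier_vec n)"
  have "embedding_map (coord_top n) ?M ?\<phi>"
  proof (rule embedding_map_left_inverse[OF continuous_map_lie_chart])
    show "continuous_map (subtopology ?M (?\<phi> ` topspace (coord_top n))) (coord_top n) (orbit_coords n)"
      unfolding orbit_top_def subtopology_subtopology
      by (rule continuous_map_orbit_coords) (auto simp: lie_chart_image[simplified])
    show "orbit_coords n (?\<phi> p) = p" if "p \<in> topspace (coord_top n)" for p
      using that orbit_coords_lie_chart by auto
  qed
  moreover have "openin ?M ?S"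
  proof -
    have "continuous_map ?M euclidean (row_norm n)"
      unfolding orbit_top_def by (intro continuous_map_from_subtopology continuous_map_row_norm)
    then have "openin ?M {A \<in> topspace ?M. row_norm n A \<in> - {0}}"
      by (rule openin_continuous_map_preimage) auto
    then show ?thesis unfolding topspace_orbit_top lie_chart_image by simp
  qed
  moreover have "?M closure_of ?S = topspace ?M"
    by (intro subset_antisym closure_of_subset_topspace subsetI lie_chart_dense)
       (simp only: topspace_orbit_top)
  ultimately show ?thesis by (simp add: dense_open_chart_def)
qed

section \<open>The cotangent chart\<close>

abbreviation pair_top :: "nat \<Rightarrow> (complex vec \<times> complex vec) topology" where
  "pair_top n \<equiv> subtopology (coord_top (n + 1)) (cot_pairs n)"

text \<open>These are the expressions invariant under (z, \<xi>) \<sim> (s z, \<xi>/s) that result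
  from rescaling to first coordinate 1. They are meaningful only for z $ 0 \<noteq> 0.\<close>

definition affine_coords :: "nat \<Rightarrow> complex vec \<times> complex vec \<Rightarrow> complex vec \<times> complex vec" where
  "affine_coords n = (\<lambda>(z, \<xi>). (vec n (\<lambda>k. z $ Suc k / z $ 0), vec n (\<lambda>k. z $ 0 * \<xi> $ Suc k)))"

text \<open>A lift of the chart to representatives: it reduces continuity into the quotient to
  continuity of explicit vectors.\<close>

definition chart_pair :: "complex vec \<times> complex vec \<Rightarrow> complex vec \<times> complex vec" where
  "chart_pair = (\<lambda>(x, y). (vCons 1 x, vCons (- (x \<bullet> y)) y))"

lemma cot_chart_eq: "cot_chart n p = cot_class (chart_pair p)"
  by (simp add: cot_chart_def chart_pair_def split: prod.split)

lemma chart_pair_mem_cot_pairs: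
  assumes x: "x \<in> carrier_vec n" and y: "y \<in> carrier_vec n"
  shows "chart_pair (x, y) \<in> cot_pairs n"
proof -
  have "vCons 1 x \<noteq> 0\<^sub>v (n + 1)"
  proof
    assume "vCons 1 x = 0\<^sub>v (n + 1)"
    then have "vCons 1 x $ 0 = 0\<^sub>v (n + 1) $ 0" by simp
    then show False by simp
  qed
  moreover have "y \<bullet> x = x \<bullet> y" by (rule comm_scalar_prod[OF y x])
  then have "vCons (- (x \<bullet> y)) y \<bullet> vCons 1 x = 0"
    using x y by (simp add: scalar_prod_vCons)
  ultimately show ?thesis using x y by (auto simp: cot_pairs_def chart_pair_def)
qed

text \<open>The nonzero factor s only reparametrises the class: the scalar u corresponds to u s in
  one direction and to u / s in the other.\<close>

lemma cot_class_eqI: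
  assumes "s \<noteq> 0"
  shows "cot_class (s \<cdot>\<^sub>v z, inverse s \<cdot>\<^sub>v \<xi>) = cot_class (z, \<xi>)"
proof -
  have "(\<exists>u. a = u \<cdot>\<^sub>v (s \<cdot>\<^sub>v z) \<and> b = inverse u \<cdot>\<^sub>v (inverse s \<cdot>\<^sub>v \<xi>) \<and> u \<noteq> 0) \<longleftrightarrow>
    (\<exists>u. a = u \<cdot>\<^sub>v z \<and> b = inverse u \<cdot>\<^sub>v \<xi> \<and> u \<noteq> 0)" for a b
  proof
    assume "\<exists>u. a = u \<cdot>\<^sub>v (s \<cdot>\<^sub>v z) \<and> b = inverse u \<cdot>\<^sub>v (inverse s \<cdot>\<^sub>v \<xi>) \<and> u \<noteq> 0"
    then obtain u where "a = u \<cdot>\<^sub>v (s \<cdot>\<^sub>v z)" "b = inverse u \<cdot>\<^sub>v (inverse s \<cdot>\<^sub>v \<xi>)" "u \<noteq> 0" by blast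
    then show "\<exists>u. a = u \<cdot>\<^sub>v z \<and> b = inverse u \<cdot>\<^sub>v \<xi> \<and> u \<noteq> 0"
      using assms by (intro exI[of _ "u * s"]) (simp add: smult_smult_assoc)
  next
    assume "\<exists>u. a = u \<cdot>\<^sub>v z \<and> b = inverse u \<cdot>\<^sub>v \<xi> \<and> u \<noteq> 0"
    then obtain u where "a = u \<cdot>\<^sub>v z" "b = inverse u \<cdot>\<^sub>v \<xi>" "u \<noteq> 0" by blast
    then show "\<exists>u. a = u \<cdot>\<^sub>v (s \<cdot>\<^sub>v z) \<and> b = inverse u \<cdot>\<^sub>v (inverse s \<cdot>\<^sub>v \<xi>) \<and> u \<noteq> 0"
      using assms by (intro exI[of _ "u / s"]) (simp add: smult_smult_assoc inverse_eq_divide)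
  qed
  then show ?thesis unfolding cot_class_def by auto
qed

lemma cot_class_eqD:
  assumes "cot_class (z, \<xi>) = cot_class (z', \<xi>')"
  obtains s where "s \<noteq> 0" "z = s \<cdot>\<^sub>v z'" "\<xi> = inverse s \<cdot>\<^sub>v \<xi>'"
proof -
  have "(z, \<xi>) \<in> cot_class (z, \<xi>)" unfolding cot_class_def by (auto intro!: exI[of _ 1])
  then show thesis using that unfolding assms by (auto simp: cot_class_def)
qed

lemma affine_coords_carrier: "affine_coords n q \<in> carrier_vec n \<times> carrier_vec n"
  by (auto simp: affine_coords_def split: prod.split)

lemma affine_coords_chart_pair:
  "x \<in> carrier_vec n \<Longrightarrow> y \<in> carrier_vec n \<Longrightarrow> affine_coords n (chart_pair (x, y)) = (x, y)"
  by (auto simp: affine_coords_def chart_pair_def)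

text \<open>The scalar relating the two representatives is z $ 0. All entries match by construction
  except the first entry of \<xi>, which is determined by \<xi> \<bullet> z = 0.\<close>

lemma cot_class_affine_coords:
  assumes q: "(z, \<xi>) \<in> cot_pairs n" and z0: "z $ 0 \<noteq> 0"
  shows "cot_class (z, \<xi>) = cot_chart n (affine_coords n (z, \<xi>))"
proof -
  have z: "z \<in> carrier_vec (Suc n)" and \<xi>: "\<xi> \<in> carrier_vec (Suc n)" and 0: "\<xi> \<bullet> z = 0"
    using q by (auto simp: cot_pairs_def)
  define x where "x = vec n (\<lambda>k. z $ Suc k / z $ 0)"
  define y where "y = vec n (\<lambda>k. z $ 0 * \<xi> $ Suc k)"
  have "x \<bullet> y = (\<Sum>k<n. \<xi> $ Suc k * z $ Suc k)"
    using z0 by (simp add: scalar_prod_def x_def y_def atLeast0LessThan mult.commute)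
  also have "\<dots> = - \<xi> $ 0 * z $ 0"
    using 0 z by (simp add: scalar_prod_def sum.atLeast0_lessThan_Suc_shift atLeast0LessThan
        sum.lessThan_Suc_shift add_eq_0_iff del: sum.op_ivl_Suc sum.lessThan_Suc)
  finally have xy: "x \<bullet> y = - \<xi> $ 0 * z $ 0" .
  have "z = z $ 0 \<cdot>\<^sub>v vCons 1 x"
  proof (rule eq_vecI)
    fix i assume "i < dim_vec (z $ 0 \<cdot>\<^sub>v vCons 1 x)"
    then show "z $ i = (z $ 0 \<cdot>\<^sub>v vCons 1 x) $ i"
      using z0 by (cases i) (auto simp: x_def)
  qed (use z in \<open>simp add: x_def\<close>)
  moreover have "\<xi> = inverse (z $ 0) \<cdot>\<^sub>v vCons (- (x \<bullet> y)) y"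
  proof (rule eq_vecI)
    fix i assume "i < dim_vec (inverse (z $ 0) \<cdot>\<^sub>v vCons (- (x \<bullet> y)) y)"
    then show "\<xi> $ i = (inverse (z $ 0) \<cdot>\<^sub>v vCons (- (x \<bullet> y)) y) $ i"
      using z0 by (cases i) (auto simp: xy, auto simp: y_def)
  qed (use \<xi> in \<open>simp add: y_def\<close>)
  ultimately have "cot_class (z, \<xi>) = cot_class (vCons 1 x, vCons (- (x \<bullet> y)) y)"
    using cot_class_eqI[OF z0, of "vCons 1 x" "vCons (- (x \<bullet> y)) y"] by simp
  then show ?thesis by (simp add: cot_chart_def affine_coords_def x_def y_def)
qed

text \<open>If z = s (1, x), then s is z $ 0, and the affine coordinates do not see the scaling.
  Both injectivity and openness of the chart rest on this.\<close>

lemma cot_class_eq_cot_chart_iff: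
  assumes q: "(z, \<xi>) \<in> cot_pairs n" and x: "x \<in> carrier_vec n" and y: "y \<in> carrier_vec n"
  shows "cot_class (z, \<xi>) = cot_chart n (x, y) \<longleftrightarrow> z $ 0 \<noteq> 0 \<and> affine_coords n (z, \<xi>) = (x, y)"
    (is "?L \<longleftrightarrow> ?R")
proof
  assume ?L
  then have "cot_class (z, \<xi>) = cot_class (vCons 1 x, vCons (- (x \<bullet> y)) y)"
    by (simp add: cot_chart_def)
  then obtain s where s: "s \<noteq> 0" "z = s \<cdot>\<^sub>v vCons 1 x" "\<xi> = inverse s \<cdot>\<^sub>v vCons (- (x \<bullet> y)) y"
    by (rule cot_class_eqD)
  then show ?R using x y by (auto simp: affine_coords_def)
next
  assume ?R
  then show ?L using cot_class_affine_coords[OF q] by simp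
qed

lemma inj_on_cot_chart: "inj_on (cot_chart n) (carrier_vec n \<times> carrier_vec n)"
proof (rule inj_onI, clarify)
  fix x y x' y' :: "complex vec"
  assume c: "x \<in> carrier_vec n" "y \<in> carrier_vec n" "x' \<in> carrier_vec n" "y' \<in> carrier_vec n"
    and eq: "cot_chart n (x, y) = cot_chart n (x', y')"
  obtain z \<xi> where z: "chart_pair (x, y) = (z, \<xi>)" by force
  have "affine_coords n (z, \<xi>) = (x', y')"
    using cot_class_eq_cot_chart_iff[of z \<xi> n x' y'] c chart_pair_mem_cot_pairs[of x n y] eq z
    by (simp add: cot_chart_eq)
  then show "x = x' \<and> y = y'" using affine_coords_chart_pair[of x n y] c z by simp
qed

lemma cot_chart_image: "cot_chart n ` (carrier_vec n \<times> carrier_vec n) = V0 n"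
proof
  show "cot_chart n ` (carrier_vec n \<times> carrier_vec n) \<subseteq> V0 n"
  proof clarify
    fix x y :: "complex vec" assume "x \<in> carrier_vec n" "y \<in> carrier_vec n"
    then have "chart_pair (x, y) \<in> {(z, \<xi>) \<in> cot_pairs n. z $ 0 \<noteq> 0}"
      using chart_pair_mem_cot_pairs[of x n y] by (auto simp: chart_pair_def)
    then show "cot_chart n (x, y) \<in> V0 n"
      unfolding V0_def cot_chart_eq by (rule imageI)
  qed
  show "V0 n \<subseteq> cot_chart n ` (carrier_vec n \<times> carrier_vec n)"
    unfolding V0_def
  proof clarify
    fix z \<xi> assume "(z, \<xi>) \<in> cot_pairs n" "z $ 0 \<noteq> 0"
    then have "cot_class (z, \<xi>) = cot_chart n (affine_coords n (z, \<xi>))"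
      by (rule cot_class_affine_coords)
    then show "cot_class (z, \<xi>) \<in> cot_chart n ` (carrier_vec n \<times> carrier_vec n)"
      using affine_coords_carrier by (rule image_eqI)
  qed
qed

section \<open>The chart and the quotient topology\<close>

lemma topspace_pair_top: "topspace (pair_top n) = cot_pairs n"
  by (auto simp: cot_pairs_def)

lemma continuous_map_cot_class: "continuous_map (pair_top n) (cot_top n) cot_class"
  unfolding continuous_map_def topspace_pair_top by (auto simp: openin_cot_top cot_proj_def)

lemma continuous_map_chart_pair: "continuous_map (coord_top n) (pair_top n) chart_pair"
proof -
  have "continuous_map (coord_top n) (coord_top (n + 1))
      (\<lambda>p. (vCons 1 (fst p), vCons (- (fst p \<bullet> snd p)) (snd p)))"
  proof (intro continuous_map_pairedI continuous_map_vec_top)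
    fix i assume i: "i < n + 1"
    show "continuous_map (coord_top n) euclidean (\<lambda>p. vCons 1 (fst p) $ i)"
      using i by (cases i) (auto intro!: continuous_map_fst_index
          intro: continuous_map_eq[OF continuous_map_fst_index])
    show "continuous_map (coord_top n) euclidean (\<lambda>p. vCons (- (fst p \<bullet> snd p)) (snd p) $ i)"
    proof (cases i)
      case 0
      have "continuous_map (coord_top n) euclidean (\<lambda>p. - (\<Sum>k<n. fst p $ k * snd p $ k))"
        by (intro continuous_map_minus continuous_map_sum continuous_map_mult_algebra
            continuous_map_fst_index continuous_map_snd_index) auto
      then show ?thesis
        by (rule continuous_map_eq) (auto simp: 0 scalar_prod_def atLeast0LessThan)
    next
      case (Suc k)
      then have "continuous_map (coord_top n) euclidean (\<lambda>p. snd p $ k)"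
        using i by (intro continuous_map_snd_index) simp
      then show ?thesis by (rule continuous_map_eq) (use Suc i in auto)
    qed
  qed auto
  then show ?thesis
    using chart_pair_mem_cot_pairs[of _ n]
    by (auto simp: continuous_map_in_subtopology chart_pair_def case_prod_unfold)
qed

lemma continuous_map_affine_coords:
  "continuous_map (subtopology (pair_top n) {q \<in> cot_pairs n. fst q $ 0 \<noteq> 0}) (coord_top n) (affine_coords n)"
proof -
  let ?T = "subtopology (pair_top n) {q \<in> cot_pairs n. fst q $ 0 \<noteq> 0}"
  have f: "continuous_map ?T euclidean (\<lambda>q. fst q $ i)"
    and s: "continuous_map ?T euclidean (\<lambda>q. snd q $ i)" if "i < n + 1" for i
    by (intro continuous_map_from_subtopology continuous_map_fst_index continuous_map_snd_index that)+
  show ?thesis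
    unfolding affine_coords_def case_prod_unfold
  proof (intro continuous_map_pairedI continuous_map_vec_top)
    fix i assume i: "i < n"
    show "continuous_map ?T euclidean (\<lambda>q. vec n (\<lambda>k. fst q $ Suc k / fst q $ 0) $ i)"
      unfolding index_vec[OF i] using i by (intro continuous_map_divide_field f) auto
    show "continuous_map ?T euclidean (\<lambda>q. vec n (\<lambda>k. fst q $ 0 * snd q $ Suc k) $ i)"
      unfolding index_vec[OF i] using i by (intro continuous_map_mult_algebra f s) auto
  qed auto
qed

lemma openin_nonzero_coord: "openin (pair_top n) {q \<in> cot_pairs n. fst q $ 0 \<noteq> 0}"
proof -
  have "continuous_map (pair_top n) euclidean (\<lambda>q. fst q $ 0)"
    by (intro continuous_map_from_subtopology continuous_map_fst_index) simp
  then have "openin (pair_top n) {q \<in> topspace (pair_top n). fst q $ 0 \<in> - {0}}"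
    by (rule openin_continuous_map_preimage) auto
  then show ?thesis unfolding topspace_pair_top by simp
qed

text \<open>In the quotient topology it suffices that the preimage among the pairs is open. That
  preimage consists of the pairs with z $ 0 \<noteq> 0 whose affine coordinates lie in U, and these
  coordinates are continuous on an open set.\<close>

lemma open_map_cot_chart: "open_map (coord_top n) (cot_top n) (cot_chart n)"
  unfolding open_map_def
proof (intro allI impI)
  fix U assume U: "openin (coord_top n) U"
  then have sub: "U \<subseteq> carrier_vec n \<times> carrier_vec n"
    using openin_subset by fastforce
  let ?D = "{q \<in> cot_pairs n. fst q $ 0 \<noteq> 0}"
  have "topspace (subtopology (pair_top n) ?D) = ?D"
    unfolding topspace_subtopology[of "pair_top n"] topspace_pair_top by auto
  then have "openin (subtopology (pair_top n) ?D) {q \<in> ?D. affine_coords n q \<in> U}"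
    using openin_continuous_map_preimage[OF continuous_map_affine_coords U] by simp
  then have "openin (pair_top n) {q \<in> ?D. affine_coords n q \<in> U}"
    by (rule openin_trans_full) (rule openin_nonzero_coord)
  moreover have "{q \<in> ?D. affine_coords n q \<in> U} = {q \<in> cot_pairs n. cot_class q \<in> cot_chart n ` U}"
  proof -
    have "cot_class q \<in> cot_chart n ` U \<longleftrightarrow> fst q $ 0 \<noteq> 0 \<and> affine_coords n q \<in> U"
      if "q \<in> cot_pairs n" for q
    proof -
      obtain z \<xi> where q: "q = (z, \<xi>)" by force
      have "cot_class (z, \<xi>) = cot_chart n p \<longleftrightarrow> z $ 0 \<noteq> 0 \<and> affine_coords n (z, \<xi>) = p"
        if "p \<in> U" for p
      proof -
        obtain x y where p: "p = (x, y)" by force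
        then have "x \<in> carrier_vec n" "y \<in> carrier_vec n" using sub that by auto
        then show ?thesis
          using \<open>q \<in> cot_pairs n\<close> unfolding q p by (intro cot_class_eq_cot_chart_iff)
      qed
      then show ?thesis unfolding q image_iff by auto
    qed
    then show ?thesis by blast
  qed
  moreover have "cot_chart n ` U \<subseteq> cot_proj n"
  proof -
    have "cot_chart n ` U \<subseteq> V0 n" unfolding cot_chart_image[symmetric] using sub by (rule image_mono)
    also have "V0 n \<subseteq> cot_proj n" by (auto simp: V0_def cot_proj_def)
    finally show ?thesis .
  qed
  ultimately show "openin (cot_top n) (cot_chart n ` U)"
    by (simp add: openin_cot_top)
qed

section \<open>Density of the image of the cotangent chart\<close>

lemma V0_dense:
  assumes q: "(z, \<xi>) \<in> cot_pairs n"
  shows "cot_class (z, \<xi>) \<in> cot_top n closure_of (V0 n)"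
proof (cases "z $ 0 = 0")
  case False
  then have "cot_class (z, \<xi>) \<in> V0 n" using q by (auto simp: V0_def)
  moreover have "V0 n \<subseteq> topspace (cot_top n)" by (auto simp: V0_def cot_proj_def)
  ultimately show ?thesis using closure_of_subset by blast
next
  case True
  have z: "z \<in> carrier_vec (Suc n)" and \<xi>: "\<xi> \<in> carrier_vec (Suc n)" and 0: "\<xi> \<bullet> z = 0"
    and z0: "z \<noteq> 0\<^sub>v (n + 1)"
    using q by (auto simp: cot_pairs_def)
  obtain l where l: "l < Suc n" "z $ l \<noteq> 0"
  proof -
    have "\<exists>l < Suc n. z $ l \<noteq> 0"
      using z z0 by (metis Suc_eq_plus1 carrier_vecD eq_vecI index_zero_vec)
    then show thesis using that by blast
  qed
  then have l0: "l \<noteq> 0" using True by (cases l) auto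
  \<comment> \<open>Raising the first coordinate of z from 0 to e adds e \<xi>_0 to the pairing. The
    correction of \<xi> in coordinate l contributes -e \<xi>_0, because it is divided by
    z_l.\<close>
  define Z where "Z e = vec (n + 1) (\<lambda>i. if i = 0 then e else z $ i)" for e
  define \<Xi> where "\<Xi> e = vec (n + 1) (\<lambda>i. \<xi> $ i - (if i = l then e * (\<xi> $ 0 / z $ l) else 0))" for e
  have "\<Xi> e \<bullet> Z e = 0" for e
  proof -
    have "\<Xi> e \<bullet> Z e = (\<Sum>i<Suc n. \<xi> $ i * z $ i + (if i = 0 then e * \<xi> $ 0 else 0) -
        (if i = l then e * \<xi> $ 0 else 0))"
      unfolding scalar_prod_def atLeast0LessThan using True l l0
      by (intro sum.cong) (auto simp: Z_def \<Xi>_def algebra_simps)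
    also have "\<dots> = \<xi> \<bullet> z"
      unfolding sum_subtractf sum.distrib scalar_prod_def atLeast0LessThan
      using l z by (simp del: sum.lessThan_Suc)
    finally show ?thesis using 0 by simp
  qed
  \<comment> \<open>Coordinate l is left untouched, so the perturbed vector stays nonzero for every
    e, including 0.\<close>
  moreover have "Z e \<noteq> 0\<^sub>v (n + 1)" for e
  proof
    assume "Z e = 0\<^sub>v (n + 1)"
    then have "Z e $ l = 0" using l by simp
    then show False using l l0 by (simp add: Z_def)
  qed
  ultimately have mem: "(Z e, \<Xi> e) \<in> cot_pairs n" for e
    by (simp add: cot_pairs_def Z_def \<Xi>_def)
  have "continuous_map euclidean (coord_top (n + 1)) (\<lambda>e. (Z e, \<Xi> e))"
  proof (intro continuous_map_pairedI continuous_map_vec_top)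
    fix i assume i: "i < n + 1"
    show "continuous_map euclidean euclidean (\<lambda>e. Z e $ i)"
      unfolding Z_def index_vec[OF i] by (cases "i = 0"; simp)
    show "continuous_map euclidean euclidean (\<lambda>e. \<Xi> e $ i)"
      unfolding \<Xi>_def index_vec[OF i] using l by (cases "i = l"; simp; intro continuous_intros; simp)
  qed (auto simp: Z_def \<Xi>_def)
  then have "continuous_map euclidean (pair_top n) (\<lambda>e. (Z e, \<Xi> e))"
    using mem by (auto simp: continuous_map_in_subtopology)
  from continuous_map_compose[OF this continuous_map_cot_class]
  have "continuous_map euclidean (cot_top n) (\<lambda>e. cot_class (Z e, \<Xi> e))" by (simp add: o_def)
  moreover have "cot_class (Z e, \<Xi> e) \<in> V0 n" if "e \<noteq> 0" for e
    using mem[of e] that by (auto simp: V0_def Z_def)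
  ultimately have "cot_class (Z 0, \<Xi> 0) \<in> cot_top n closure_of (V0 n)"
    by (rule in_closure_of_curve)
  moreover have "Z 0 = z" "\<Xi> 0 = \<xi>"
    using True z \<xi> by (auto simp: Z_def \<Xi>_def)
  ultimately show ?thesis by simp
qed

text \<open>Here the embedding comes from injectivity and openness, so no inverse on equivalence
  classes has to be written down.\<close>

lemma dense_open_chart_cot_chart:
  "dense_open_chart (coord_top n) (cot_top n) (cot_chart n)"
proof -
  have top: "topspace (coord_top n) = carrier_vec n \<times> carrier_vec n" by simp
  have "continuous_map (coord_top n) (cot_top n) (cot_class \<circ> chart_pair)"
    by (rule continuous_map_compose[OF continuous_map_chart_pair continuous_map_cot_class])
  then have "continuous_map (coord_top n) (cot_top n) (cot_chart n)"
    by (rule continuous_map_eq) (simp add: cot_chart_eq)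
  then have "embedding_map (coord_top n) (cot_top n) (cot_chart n)"
    by (rule injective_open_imp_embedding_map[OF _ open_map_cot_chart])
       (simp add: inj_on_cot_chart)
  moreover have "openin (cot_top n) (cot_chart n ` topspace (coord_top n))"
    using open_map_cot_chart unfolding open_map_def by blast
  moreover have "cot_proj n \<subseteq> cot_top n closure_of V0 n"
    using V0_dense by (auto simp: cot_proj_def)
  then have "cot_top n closure_of (cot_chart n ` topspace (coord_top n)) = topspace (cot_top n)"
    unfolding top cot_chart_image topspace_cot_top
    by (metis closure_of_subset_topspace subset_antisym topspace_cot_top)
  ultimately show ?thesis by (simp add: dense_open_chart_def)
qed

section \<open>The potentials\<close>

lemma toric_potential_cot_chart:
  assumes "x \<in> carrier_vec n" "y \<in> carrier_vec n"
  shows "toric_potential n c (cot_chart n (x, y)) = c - (\<Sum>i<n. 2 * of_nat (Suc i) * x $ i * y $ i)"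
  using inv_into_f_f[OF inj_on_cot_chart, of "(x, y)" n] assms by (simp add: toric_potential_def)

text \<open>Equal gaps s make \<lambda>_1 - \<lambda>_(i+1) = -s i, and the shift by n/2 makes the
  trace zero. The gap remains a parameter because the two normalisations of the Lie potential
  require different values.\<close>

definition spaced_diag :: "nat \<Rightarrow> real \<Rightarrow> complex mat" where
  "spaced_diag n s = mat_diag (n + 1) (\<lambda>i. of_real (s * (real i - real n / 2)))"

lemma spaced_diag_index: "i \<le> n \<Longrightarrow> spaced_diag n s $$ (i, i) = of_real (s * (real i - real n / 2))"
  by (simp add: spaced_diag_def mat_diag_def)

lemma sum_centered: "(\<Sum>i<Suc n. real i - real n / 2) = 0"
proof -
  have "2 * (\<Sum>i<Suc n. real i) = real n * (real n + 1)"
    by (induction n) (auto simp: algebra_simps)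
  then show ?thesis by (simp add: sum_subtractf algebra_simps del: sum.lessThan_Suc)
qed

lemma spaced_diag_mem_sl: "spaced_diag n s \<in> sl (n + 1)"
proof -
  have "mat_trace (spaced_diag n s) = of_real (\<Sum>i<Suc n. s * (real i - real n / 2))"
    unfolding mat_trace_def of_real_sum
    by (intro sum.cong) (auto simp: spaced_diag_def mat_diag_def)
  also have "\<dots> = 0" by (simp only: sum_distrib_left[symmetric] sum_centered) simp
  finally show ?thesis by (simp add: sl_def spaced_diag_def)
qed

lemma regular_spaced_diag: "s \<noteq> 0 \<Longrightarrow> regular_real_diag (n + 1) (spaced_diag n s)"
  unfolding regular_real_diag_def spaced_diag_def
  by (intro exI[of _ "\<lambda>i. s * (real i - real n / 2)"] conjI refl) (auto simp: inj_on_def)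

lemma min_diag_mem_sl: "min_diag n \<in> sl (n + 1)"
proof -
  have "mat_trace (min_diag n) = (\<Sum>i<Suc n. if i = 0 then of_nat n else - 1)"
    unfolding mat_trace_def by (intro sum.cong) (auto simp: min_diag_def mat_diag_def)
  also have "\<dots> = 0" by (simp add: sum.lessThan_Suc_shift del: sum.lessThan_Suc)
  finally show ?thesis by (simp add: sl_def min_diag_def)
qed

section \<open>The Lie potential of a diagonal matrix\<close>

lemma height_diag:
  assumes "A \<in> carrier_mat (n + 1) (n + 1)"
  shows "height n (mat_diag (n + 1) f) A = 2 * of_nat (n + 1) * (\<Sum>i<Suc n. f i * A $$ (i, i))"
proof -
  have "mat_trace (mat_diag (n + 1) f * A) = (\<Sum>i<Suc n. f i * A $$ (i, i))"
    unfolding mat_trace_def mat_diag_mult_left[OF assms] by (intro sum.cong) auto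
  then show ?thesis by (simp only: height_def killing_form_def)
qed

text \<open>Only the diagonal entries (n + 1) V_i W_i - 1 enter. Since V_0 W_0 = 1 + x \<bullet> y
  and the later products are the negatives of the products of the coordinates, each of these
  acquires a difference of entries of f. The constant is 2 (n + 1) times the trace of H H_0.\<close>

lemma lie_potential_diag:
  assumes x: "x \<in> carrier_vec n" and y: "y \<in> carrier_vec n"
  shows "lie_potential n (mat_diag (n + 1) f) (min_diag n) (x, y) =
    2 * of_nat (n + 1) * (of_nat (n + 1) * f 0 - (\<Sum>i<Suc n. f i)) +
    2 * of_nat (n + 1) ^ 2 * (\<Sum>i<n. (f 0 - f (Suc i)) * x $ i * y $ i)"
proof -
  let ?A = "lie_chart n (min_diag n) (x, y)" and ?N = "of_nat (Suc n) :: complex"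
  have A: "?A \<in> carrier_mat (n + 1) (n + 1)"
    unfolding lie_chart_eq[OF x y] by (rule rank_one_carrier[OF chart_col_carrier chart_row_carrier])
  have d: "?A $$ (i, i) = ?N * (chart_col n y $$ (i, 0) * chart_row n x y $$ (0, i)) - 1" if "i \<le> n" for i
    unfolding lie_chart_eq[OF x y] using rank_one_index[OF chart_col_carrier chart_row_carrier that that]
    by simp
  have "(\<Sum>i<Suc n. f i * ?A $$ (i, i)) =
      (\<Sum>i<Suc n. ?N * (f i * (chart_col n y $$ (i, 0) * chart_row n x y $$ (0, i))) - f i)"
    by (intro sum.cong) (auto simp: d algebra_simps)
  also have "\<dots> = ?N * (\<Sum>i<Suc n. f i * (chart_col n y $$ (i, 0) * chart_row n x y $$ (0, i)))
      - (\<Sum>i<Suc n. f i)"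
    by (simp only: sum_subtractf sum_distrib_left)
  also have "(\<Sum>i<Suc n. f i * (chart_col n y $$ (i, 0) * chart_row n x y $$ (0, i))) =
      f 0 * (1 + x \<bullet> y) - (\<Sum>i<n. f (Suc i) * x $ i * y $ i)"
    by (simp add: sum.lessThan_Suc_shift chart_col_def chart_row_def sum_negf mult_ac
        del: sum.lessThan_Suc)
  also have "\<dots> = f 0 + (\<Sum>i<n. (f 0 - f (Suc i)) * x $ i * y $ i)"
    using y by (simp add: scalar_prod_def atLeast0LessThan sum_distrib_left sum_subtractf algebra_simps)
  finally have "lie_potential n (mat_diag (n + 1) f) (min_diag n) (x, y) =
      2 * ?N * (?N * (f 0 + (\<Sum>i<n. (f 0 - f (Suc i)) * x $ i * y $ i)) - (\<Sum>i<Suc n. f i))"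
    unfolding lie_potential_def height_diag[OF A] by (simp only: Suc_eq_plus1)
  then show ?thesis
    by (simp only: Suc_eq_plus1) (simp only: power2_eq_square distrib_left right_diff_distrib mult_ac
      diff_add_eq)
qed

text \<open>The sum of the diagonal vanishes and its first entry is -s n / 2, which gives the
  constant. The differences -s (i + 1) are -s / 2 times the toric weights 2 (i + 1).\<close>

lemma lie_potential_spaced_diag:
  assumes x: "x \<in> carrier_vec n" and y: "y \<in> carrier_vec n"
  shows "lie_potential n (spaced_diag n s) (min_diag n) (x, y) =
    - (of_nat (n + 1) ^ 2 * of_nat n * of_real s)
      - of_nat (n + 1) ^ 2 * of_real s * (\<Sum>i<n. 2 * of_nat (Suc i) * x $ i * y $ i)"
proof -
  have "(\<Sum>i<Suc n. complex_of_real (s * (real i - real n / 2))) = 0"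
    unfolding of_real_sum[symmetric] sum_distrib_left[symmetric] sum_centered by simp
  moreover have "(\<Sum>i<n. (of_real (s * (real 0 - real n / 2)) - of_real (s * (real (Suc i) - real n / 2)))
      * x $ i * y $ i) = - of_real s / 2 * (\<Sum>i<n. 2 * of_nat (Suc i) * x $ i * y $ i)"
    unfolding sum_distrib_left by (intro sum.cong) (auto simp: algebra_simps)
  ultimately show ?thesis
    unfolding spaced_diag_def lie_potential_diag[OF x y]
    by (simp add: power2_eq_square del: sum.lessThan_Suc of_nat_Suc)
qed

lemma lie_potential_formula_spaced_diag:
  "lie_potential_formula n (spaced_diag n s) H\<^sub>0 (x, y) =
    mat_trace (spaced_diag n s * H\<^sub>0) - of_real (s / 2) * (\<Sum>i<n. 2 * of_nat (Suc i) * x $ i * y $ i)"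
proof -
  have "(\<Sum>i<n. (spaced_diag n s $$ (0, 0) - spaced_diag n s $$ (Suc i, Suc i)) * x $ i * y $ i) =
      - of_real (s / 2) * (\<Sum>i<n. 2 * of_nat (Suc i) * x $ i * y $ i)"
    unfolding sum_distrib_left
    by (intro sum.cong) (auto simp: spaced_diag_index algebra_simps)
  then show ?thesis by (simp add: lie_potential_formula_def)
qed

theorem theorem5p2:
  fixes n :: nat
  shows "(\<exists>H \<in> sl (n + 1). \<exists>H\<^sub>0 \<in> sl (n + 1). \<exists>c :: complex.
            regular_real_diag (n + 1) H \<and> H\<^sub>0 = min_diag n \<and>
            dense_open_chart (coord_top n) (orbit_top n H\<^sub>0) (lie_chart n H\<^sub>0) \<and>
            dense_open_chart (coord_top n) (cot_top n) (cot_chart n) \<and>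
            cot_chart n ` (carrier_vec n \<times> carrier_vec n) = V0 n \<and>
            (\<forall>x \<in> carrier_vec n. \<forall>y \<in> carrier_vec n.
               lie_potential n H H\<^sub>0 (x, y) = toric_potential n c (cot_chart n (x, y))))
       \<and> (\<exists>H \<in> sl (n + 1). \<exists>H\<^sub>0 \<in> sl (n + 1). \<exists>c :: complex.
            regular_real_diag (n + 1) H \<and> H\<^sub>0 = min_diag n \<and>
            (\<forall>x \<in> carrier_vec n. \<forall>y \<in> carrier_vec n.
               lie_potential_formula n H H\<^sub>0 (x, y) = toric_potential n c (cot_chart n (x, y))))"
proof (intro conjI)
  \<comment> \<open>This gap makes the coefficient (n + 1)^2 s equal to 1; the constant term is then
    -n, the value taken for c.\<close>
  define s where "s = 1 / (real (n + 1))\<^sup>2"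
  have s: "s \<noteq> 0" and Ns: "of_nat (n + 1) ^ 2 * complex_of_real s = 1"
    unfolding s_def by (simp_all del: of_nat_Suc of_nat_add)
  have "\<forall>x \<in> carrier_vec n. \<forall>y \<in> carrier_vec n. lie_potential n (spaced_diag n s) (min_diag n) (x, y) =
      toric_potential n (- of_nat n) (cot_chart n (x, y))"
  proof (intro ballI)
    fix x y :: "complex vec" assume xy: "x \<in> carrier_vec n" "y \<in> carrier_vec n"
    have "of_nat (n + 1) ^ 2 * of_nat n * complex_of_real s = of_nat n * (of_nat (n + 1) ^ 2 * of_real s)"
      by (simp only: mult_ac mult_minus_left mult_minus_right)
    then show "lie_potential n (spaced_diag n s) (min_diag n) (x, y) =
        toric_potential n (- of_nat n) (cot_chart n (x, y))"
      unfolding lie_potential_spaced_diag[OF xy] toric_potential_cot_chart[OF xy] Ns by simp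
  qed
  then show "\<exists>H \<in> sl (n + 1). \<exists>H\<^sub>0 \<in> sl (n + 1). \<exists>c :: complex.
      regular_real_diag (n + 1) H \<and> H\<^sub>0 = min_diag n \<and>
      dense_open_chart (coord_top n) (orbit_top n H\<^sub>0) (lie_chart n H\<^sub>0) \<and>
      dense_open_chart (coord_top n) (cot_top n) (cot_chart n) \<and>
      cot_chart n ` (carrier_vec n \<times> carrier_vec n) = V0 n \<and>
      (\<forall>x \<in> carrier_vec n. \<forall>y \<in> carrier_vec n.
         lie_potential n H H\<^sub>0 (x, y) = toric_potential n c (cot_chart n (x, y)))"
    by (intro bexI[OF _ spaced_diag_mem_sl[of n s]] bexI[OF _ min_diag_mem_sl] exI conjI refl
        regular_spaced_diag s dense_open_chart_lie_chart dense_open_chart_cot_chart cot_chart_image)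
next
  \<comment> \<open>In the closed form the coefficient is s / 2, so the gap is 2, and c is the trace
    itself.\<close>
  have "\<forall>x \<in> carrier_vec n. \<forall>y \<in> carrier_vec n. lie_potential_formula n (spaced_diag n 2) (min_diag n) (x, y) =
      toric_potential n (mat_trace (spaced_diag n 2 * min_diag n)) (cot_chart n (x, y))"
    by (simp add: lie_potential_formula_spaced_diag toric_potential_cot_chart)
  moreover have "regular_real_diag (n + 1) (spaced_diag n 2)" by (rule regular_spaced_diag) simp
  ultimately show "\<exists>H \<in> sl (n + 1). \<exists>H\<^sub>0 \<in> sl (n + 1). \<exists>c :: complex.
      regular_real_diag (n + 1) H \<and> H\<^sub>0 = min_diag n \<and>
      (\<forall>x \<in> carrier_vec n. \<forall>y \<in> carrier_vec n.
         lie_potential_formula n H H\<^sub>0 (x, y) = toric_potential n c (cot_chart n (x, y)))"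
    using spaced_diag_mem_sl[of n 2] min_diag_mem_sl[of n] by blast
qed

end
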